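(* Suppose Assumption 1 holds. Let $M=I_T-X(X'X)^{-1}X'$ and $\hat\sigma^2=\frac{y'My}{T-K}$. Then $$\frac{\hat\sigma^2}{\sigma^2}=1-\frac{\sigma^2\,\alpha'\bar S^{-1}\alpha}{T-K}\Big(\sum_{t=2}^T\tilde M_{t,t-1}\Big)^2+o_p(1),$$ where $\bar S=\tilde X'\tilde X+\sigma^2(T-K)\,\alpha\alpha'$ and $\tilde M=I_T-\tilde X(\tilde X'\tilde X)^{-1}\tilde X'$.
   Context: Asymptotic framework: all objects may depend on the sample size $T$; limits, $O_p$ and $o_p$ are as $T\to\infty$; $c\in(0,1)$ and $C>0$ denote fixed constants not depending on $T$. Model: $y_t=x_t'\beta+\varepsilon_t$, $t=1,\dots,T$, with $x_t,\beta\in\mathbb R^K$; $y=(y_1,\dots,y_T)'$, $X=[x_1,\dots,x_T]'$ ($T\times K$), $\varepsilon=(\varepsilon_1,\dots,\varepsilon_T)'$. Assumption 1: (i) $x_t=\tilde x_t+\alpha\varepsilon_{t-1}$ for all $t$, where $\tilde X=[\tilde x_1,\dots,\tilde x_T]'$ is $T\times K$ of full column rank $K$; (ii) $\{\varepsilon_t\}_{t=0}^T$ are i.i.d. conditionally on $\tilde X$ with $E[\varepsilon_t\mid\tilde X]=0$, $c<\sigma^2:=E[\varepsilon_t^2\mid\tilde X]<C$ and $E[\varepsilon_t^4\mid\tilde X]<C$ almost surely; (iii) $\alpha,r\in\mathbb R^K$ are non-random with $\alpha'(\tfrac1T\tilde X'\tilde X)^{-1}\alpha=O_p(1)$ and $r'(\tfrac1T\tilde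 X'\tilde X)^{-1}r=O_p(1)$; (iv) $K$ may diverge with $T$ and $K/T<1-c$. *)

theory Defs
  imports "HOL-Probability.Probability"
begin

text \<open>A matrix is a function nat => nat => real; only the entries with row index
  below the row dimension and column index below the column dimension matter.
  Dimensions are passed explicitly, since K depends on T.\<close>

definition mmul :: "nat \<Rightarrow> (nat \<Rightarrow> nat \<Rightarrow> real) \<Rightarrow> (nat \<Rightarrow> nat \<Rightarrow> real) \<Rightarrow> nat \<Rightarrow> nat \<Rightarrow> real" where
  "mmul n A B = (\<lambda>i k. \<Sum>j<n. A i j * B j k)"

definition mtr :: "(nat \<Rightarrow> nat \<Rightarrow> real) \<Rightarrow> nat \<Rightarrow> nat \<Rightarrow> real" where
  "mtr A = (\<lambda>i j. A j i)"

definition midt :: "nat \<Rightarrow> nat \<Rightarrow> real" where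
  "midt = (\<lambda>i j. if i = j then 1 else 0)"

definition is_inv :: "nat \<Rightarrow> (nat \<Rightarrow> nat \<Rightarrow> real) \<Rightarrow> (nat \<Rightarrow> nat \<Rightarrow> real) \<Rightarrow> bool" where
  "is_inv n A B \<longleftrightarrow> (\<forall>i<n. \<forall>k<n. mmul n A B i k = midt i k \<and> mmul n B A i k = midt i k)"

definition minv :: "nat \<Rightarrow> (nat \<Rightarrow> nat \<Rightarrow> real) \<Rightarrow> nat \<Rightarrow> nat \<Rightarrow> real" where
  "minv n A = (if \<exists>B. is_inv n A B then (SOME B. is_inv n A B) else (\<lambda>_ _. 0))"

definition qform :: "nat \<Rightarrow> (nat \<Rightarrow> nat \<Rightarrow> real) \<Rightarrow> (nat \<Rightarrow> real) \<Rightarrow> real" where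
  "qform n A v = (\<Sum>i<n. \<Sum>j<n. v i * A i j * v j)"

definition full_col_rank :: "nat \<Rightarrow> nat \<Rightarrow> (nat \<Rightarrow> nat \<Rightarrow> real) \<Rightarrow> bool" where
  "full_col_rank m n A \<longleftrightarrow>
     (\<forall>v. (\<forall>i<m. (\<Sum>j<n. A i j * v j) = 0) \<longrightarrow> (\<forall>j<n. v j = 0))"

definition resid_maker :: "nat \<Rightarrow> nat \<Rightarrow> (nat \<Rightarrow> nat \<Rightarrow> real) \<Rightarrow> nat \<Rightarrow> nat \<Rightarrow> real" where
  "resid_maker m n A =
     (\<lambda>i k. midt i k - mmul n (mmul n A (minv n (mmul m (mtr A) A))) (mtr A) i k)"

definition op1 :: "'a measure \<Rightarrow> (nat \<Rightarrow> 'a \<Rightarrow> real) \<Rightarrow> bool" where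
  "op1 M Z \<longleftrightarrow> (\<forall>d>0. (\<lambda>T. measure M {\<omega>\<in>space M. \<bar>Z T \<omega>\<bar> > d}) \<longlonglongrightarrow> 0)"

definition Op1 :: "'a measure \<Rightarrow> (nat \<Rightarrow> 'a \<Rightarrow> real) \<Rightarrow> bool" where
  "Op1 M Z \<longleftrightarrow> (\<forall>e>0. \<exists>B N. \<forall>T\<ge>N. measure M {\<omega>\<in>space M. \<bar>Z T \<omega>\<bar> > B} < e)"

definition cond_prob :: "'a measure \<Rightarrow> 'a measure \<Rightarrow> 'a set \<Rightarrow> 'a \<Rightarrow> real" where
  "cond_prob M F A = real_cond_exp M F (indicator A)"

definition cond_iid :: "'a measure \<Rightarrow> 'a measure \<Rightarrow> 'i set \<Rightarrow> ('i \<Rightarrow> 'a \<Rightarrow> real) \<Rightarrow> bool" where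
  "cond_iid M F I X \<longleftrightarrow>
     (\<forall>B. (\<forall>i\<in>I. B i \<in> sets borel) \<longrightarrow>
        (AE \<omega> in M. cond_prob M F (\<Inter>i\<in>I. X i -` B i \<inter> space M) \<omega>
                  = (\<Prod>i\<in>I. cond_prob M F (X i -` B i \<inter> space M) \<omega>))) \<and>
     (\<forall>B\<in>sets borel. \<forall>i\<in>I. \<forall>j\<in>I.
        AE \<omega> in M. cond_prob M F (X i -` B \<inter> space M) \<omega> = cond_prob M F (X j -` B \<inter> space M) \<omega>)"

definition gen_sigma :: "'a measure \<Rightarrow> nat \<Rightarrow> nat \<Rightarrow> ('a \<Rightarrow> nat \<Rightarrow> nat \<Rightarrow> real) \<Rightarrow> 'a measure" where
  "gen_sigma M m n A =
     vimage_algebra (space M) (\<lambda>\<omega>. \<lambda>p\<in>{..<m}\<times>{..<n}. A \<omega> (fst p) (snd p))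
        (Pi\<^sub>M ({..<m}\<times>{..<n}) (\<lambda>_. borel))"

end

theory Submission
  imports Defs "Jordan_Normal_Form.Determinant"
begin

text \<open>
  Write \<open>e\<close> for the vector of lagged errors, \<open>u\<close> for the vector of errors, \<open>m = T - K\<close>,
  \<open>a0 = \<alpha>'(Xt'Xt)^(-1)\<alpha>\<close> and \<open>d = Xt (Xt'Xt)^(-1)\<alpha>\<close>, so that \<open>|d|\<^sup>2 = a0\<close>. Since \<open>X\<close> differs from \<open>Xt\<close>
  by the rank-one matrix \<open>e \<alpha>'\<close>, the residual sum of squares is the rational function
  \<open>U + (W h\<^sup>2 - 2 D g h - a0 D\<^sup>2) / (a0 W + g\<^sup>2)\<close> of the quadratic forms \<open>W = e'Mt e\<close>,
  \<open>D = e'Mt u\<close>, \<open>U = u'Mt u\<close> and of \<open>h = d'u\<close>, \<open>g = 1 + d'e\<close>. Given \<open>Xt\<close>,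
  the quadratic forms have variance of order \<open>T\<close> around \<open>\<sigma>\<^sup>2 m\<close>, \<open>\<sigma>\<^sup>2 \<Sum> Mt(t, t - 1)\<close> and \<open>\<sigma>\<^sup>2 m\<close>, and
  \<open>d'u\<close> and \<open>d'e\<close> have variance \<open>\<sigma>\<^sup>2 a0\<close>, of order \<open>1 / T\<close>. As \<open>m \<ge> c T\<close>, replacing the forms by their
  centres costs \<open>o\<^sub>p(1)\<close>, and Sherman-Morrison turns the result into the claimed expression.
\<close>

section \<open>Matrices indexed by natural numbers\<close>

text \<open>The assumption on \<open>\<alpha>\<close> bounds \<open>T * a0\<close> only in
  probability, whereas Chebyshev's inequality for \<open>d'u\<close> and \<open>d'e\<close> needs a
  bound that holds everywhere. Since \<open>a0\<close> is a function of \<open>Xt\<close>, the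
  indicator of \<open>T * a0 \<le> B\<close> can be absorbed into the coefficients of these linear
  forms without leaving the conditioning algebra; the rare remaining event is paid for separately.
  The quadratic forms need no truncation: \<open>Mt\<close> is a projection, so the squares of its
  entries add up to its trace \<open>m\<close>, and a variance of order \<open>T\<close> set against
  \<open>m\<^sup>2\<close> leaves order \<open>1 / T\<close>. \<open>e\<close> and \<open>u\<close>
  are shifted copies of the same errors, so they are not independent given \<open>Xt\<close>. All
  forms are therefore rewritten over one family of errors with indices \<open>{0..T}\<close>; the
  coincidences of index are what centres \<open>D\<close> at the subdiagonal sum. Once the five
  forms are near their centres, what remains is an inequality between real numbers, linear in the
  distance. Convergence in probability thus reduces to a bound at fixed \<open>T\<close> with
  explicit constants.\<close>

definition dot :: "nat \<Rightarrow> (nat \<Rightarrow> real) \<Rightarrow> (nat \<Rightarrow> real) \<Rightarrow> real" where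
  "dot n u v = (\<Sum>i<n. u i * v i)"

definition mv :: "nat \<Rightarrow> (nat \<Rightarrow> nat \<Rightarrow> real) \<Rightarrow> (nat \<Rightarrow> real) \<Rightarrow> nat \<Rightarrow> real" where
  "mv n A v = (\<lambda>i. \<Sum>j<n. A i j * v j)"

lemma mv_cong: "(\<And>j. j < n \<Longrightarrow> v j = w j) \<Longrightarrow> mv n A v = mv n A w"
  unfolding mv_def by (intro ext sum.cong) auto

lemma dot_cong: "(\<And>j. j < n \<Longrightarrow> v j = v' j) \<Longrightarrow> (\<And>j. j < n \<Longrightarrow> w j = w' j) \<Longrightarrow> dot n v w = dot n v' w'"
  unfolding dot_def by (intro sum.cong) auto

lemma dot_commute: "dot n u v = dot n v u"
  unfolding dot_def by (simp add: mult.commute)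

lemma dot_lin: "dot n (\<lambda>i. x i + c * y i) z = dot n x z + c * dot n y z"
  unfolding dot_def by (simp add: algebra_simps sum.distrib sum_distrib_left)

lemma dot_lin_right: "dot n z (\<lambda>i. x i + c * y i) = dot n z x + c * dot n z y"
  by (simp only: dot_commute[of n z] dot_lin)

lemma dot_zero: "(\<And>i. i < n \<Longrightarrow> v i = 0) \<Longrightarrow> dot n u v = 0"
  unfolding dot_def by simp

lemma dot_nonneg: "0 \<le> dot n v v"
  unfolding dot_def by (intro sum_nonneg) auto

lemma dot_self_zero: "dot n v v = 0 \<Longrightarrow> i < n \<Longrightarrow> v i = 0"
  unfolding dot_def by (subst (asm) sum_nonneg_eq_0_iff) auto

lemma mv_lin: "mv n A (\<lambda>j. x j + c * y j) = (\<lambda>i. mv n A x i + c * mv n A y i)"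
  unfolding mv_def by (simp add: algebra_simps sum.distrib sum_distrib_left)

lemma mv_scale: "mv n A (\<lambda>j. c * y j) = (\<lambda>i. c * mv n A y i)"
  unfolding mv_def by (simp add: algebra_simps sum_distrib_left)

lemma dot_mv: "dot m u (mv n A v) = dot n (mv m (mtr A) u) v"
  unfolding dot_def mv_def mtr_def sum_distrib_left sum_distrib_right
  by (subst sum.swap) (simp add: mult_ac)

lemma dot_mv_left: "dot m (mv n A v) u = dot n v (mv m (mtr A) u)"
  using dot_mv[of m u n A v] by (simp only: dot_commute)

lemma mtr_mtr [simp]: "mtr (mtr A) = A"
  by (simp add: mtr_def)

lemma mv_mmul: "mv n (mmul k A B) v = mv k A (mv n B v)"
proof
  fix i
  show "mv n (mmul k A B) v i = mv k A (mv n B v) i"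
    unfolding mv_def mmul_def sum_distrib_left sum_distrib_right
    by (subst sum.swap) (simp add: mult_ac)
qed

lemma mv_midt: "i < n \<Longrightarrow> mv n midt v i = v i"
  unfolding mv_def midt_def by (simp add: if_distrib[of "\<lambda>x. x * _"] cong: if_cong)

lemma mv_midt_column: "j < n \<Longrightarrow> mv n A (\<lambda>k. midt k j) = (\<lambda>i. A i j)"
  unfolding mv_def midt_def by (simp add: if_distrib[of "\<lambda>x. _ * x"] cong: if_cong)

lemma dot_midt: "j < n \<Longrightarrow> dot n (\<lambda>k. midt k j) v = v j"
  unfolding dot_def midt_def by (simp add: if_distrib[of "\<lambda>x. x * _"] cong: if_cong)

lemma qform_dot: "qform n A v = dot n v (mv n A v)"
  unfolding qform_def dot_def mv_def by (simp add: sum_distrib_left mult.assoc)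

section \<open>Two-sided inverses and the adjugate\<close>

lemma is_inv_mv:
  assumes "is_inv n A B" "i < n"
  shows "mv n A (mv n B v) i = v i" "mv n B (mv n A v) i = v i"
proof -
  have "mv n (mmul n A B) v i = mv n midt v i" "mv n (mmul n B A) v i = mv n midt v i"
    using assms unfolding is_inv_def by (auto simp: mv_def intro!: sum.cong)
  then show "mv n A (mv n B v) i = v i" "mv n B (mv n A v) i = v i"
    using assms(2) by (simp_all add: mv_mmul mv_midt)
qed

lemma is_inv_solve:
  assumes "is_inv n A B" "\<And>i. i < n \<Longrightarrow> mv n A x i = v i" "i < n"
  shows "mv n B v i = x i"
  using is_inv_mv(2)[OF assms(1,3), of x] mv_cong[of n "mv n A x" v B] assms(2) by simp

text \<open>Only the entries inside the \<open>n\<close> by \<open>n\<close> block are determined;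
  outside it two inverses may differ, so they need not be equal as functions.\<close>

lemma is_inv_unique:
  assumes "is_inv n A B" "is_inv n A B'" "i < n" "j < n"
  shows "B i j = B' i j"
  using is_inv_solve[OF assms(1) is_inv_mv(1)[OF assms(2)] assms(3), of "\<lambda>k. midt k j"] assms(4)
  by (simp add: mv_midt_column)

lemma minv_is_inv: "is_inv n A B \<Longrightarrow> is_inv n A (minv n A)"
  unfolding minv_def using someI[of "is_inv n A" B] by auto

text \<open>\<open>minv\<close> is a choice and says nothing about how it depends on the sample
  point. The adjugate over the determinant is an inverse given by rational functions of the entries,
  from which measurability can be read off.\<close>

definition adj_inv :: "nat \<Rightarrow> (nat \<Rightarrow> nat \<Rightarrow> real) \<Rightarrow> nat \<Rightarrow> nat \<Rightarrow> real" where
  "adj_inv n A i j = adj_mat (Matrix.mat n n (\<lambda>(i, j). A i j)) $$ (i, j)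
     / Determinant.det (Matrix.mat n n (\<lambda>(i, j). A i j))"

lemma adj_inv_is_inv:
  assumes inj: "\<And>v. (\<And>i. i < n \<Longrightarrow> mv n A v i = 0) \<Longrightarrow> (\<And>i. i < n \<Longrightarrow> v i = 0)"
  shows "is_inv n A (adj_inv n A)"
proof -
  let ?A = "Matrix.mat n n (\<lambda>(i, j). A i j)"
  have cA: "?A \<in> carrier_mat n n" by simp
  have det: "Determinant.det ?A \<noteq> 0"
  proof
    assume "Determinant.det ?A = 0"
    then obtain v where v: "v \<in> carrier_vec n" "v \<noteq> 0\<^sub>v n" "?A *\<^sub>v v = 0\<^sub>v n"
      using det_0_iff_vec_prod_zero_field[OF cA] by auto
    have "mv n A (\<lambda>i. vec_index v i) i = 0" if "i < n" for i
    proof -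
      have "vec_index (?A *\<^sub>v v) i = 0" using v(3) that by simp
      then show ?thesis using that v(1)
        by (simp add: mv_def scalar_prod_def atLeast0LessThan)
    qed
    then have "vec_index v i = 0" if "i < n" for i using inj that by blast
    then have "v = 0\<^sub>v n" using v(1) by (intro eq_vecI) auto
    with v(2) show False by simp
  qed
  have m: "(\<Sum>j<n. A i j * adj_mat ?A $$ (j, k)) = Determinant.det ?A * midt i k"
    "(\<Sum>j<n. adj_mat ?A $$ (i, j) * A j k) = Determinant.det ?A * midt i k"
    if "i < n" "k < n" for i k
  proof -
    have "(?A * adj_mat ?A) $$ (i, k) = (Determinant.det ?A \<cdot>\<^sub>m 1\<^sub>m n) $$ (i, k)"
      by (simp only: adj_mat(2)[OF cA])
    then show "(\<Sum>j<n. A i j * adj_mat ?A $$ (j, k)) = Determinant.det ?A * midt i k"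
      using that adj_mat(1)[OF cA] by (auto simp: scalar_prod_def atLeast0LessThan midt_def)
    have "(adj_mat ?A * ?A) $$ (i, k) = (Determinant.det ?A \<cdot>\<^sub>m 1\<^sub>m n) $$ (i, k)"
      by (simp only: adj_mat(3)[OF cA])
    then show "(\<Sum>j<n. adj_mat ?A $$ (i, j) * A j k) = Determinant.det ?A * midt i k"
      using that adj_mat(1)[OF cA] by (auto simp: scalar_prod_def atLeast0LessThan midt_def)
  qed
  show ?thesis
    unfolding is_inv_def mmul_def adj_inv_def
    using det m by (simp add: sum_divide_distrib[symmetric] times_divide_eq_left)
qed

text \<open>By the Leibniz formula the determinant is a polynomial in the entries.\<close>

lemma measurable_det:
  assumes "\<And>i j. i < n \<Longrightarrow> j < n \<Longrightarrow> (\<lambda>\<omega>. A \<omega> i j) \<in> borel_measurable N"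
  shows "(\<lambda>\<omega>. Determinant.det (Matrix.mat n n (\<lambda>(i, j). A \<omega> i j)) :: real) \<in> borel_measurable N"
proof -
  have "(\<lambda>\<omega>. \<Sum>p\<in>{p. p permutes {0..<n}}. signof p * (\<Prod>i = 0..<n. A \<omega> i (p i))) \<in> borel_measurable N"
    by (intro borel_measurable_sum borel_measurable_times borel_measurable_prod borel_measurable_const assms)
      (auto simp: permutes_in_image)
  also have "(\<lambda>\<omega>. \<Sum>p\<in>{p. p permutes {0..<n}}. signof p * (\<Prod>i = 0..<n. A \<omega> i (p i))) =
     (\<lambda>\<omega>. Determinant.det (Matrix.mat n n (\<lambda>(i, j). A \<omega> i j)) :: real)"
    by (subst det_def') (auto intro!: ext sum.cong prod.cong simp: permutes_in_image)
  finally show ?thesis .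
qed

lemma measurable_adj_inv:
  assumes A: "\<And>i j. i < n \<Longrightarrow> j < n \<Longrightarrow> (\<lambda>\<omega>. A \<omega> i j) \<in> borel_measurable N"
    and ij: "i < n" "j < n"
  shows "(\<lambda>\<omega>. adj_inv n (A \<omega>) i j) \<in> borel_measurable N"
proof -
  \<comment> \<open>The adjugate is the transposed cofactor matrix, so entry \<open>(i, j)\<close>
    deletes row \<open>j\<close> and column \<open>i\<close>; the shifts by \<open>Suc\<close> skip
    these indices.\<close>
  let ?f = "\<lambda>\<omega> a b. A \<omega> (if a < j then a else Suc a) (if b < i then b else Suc b)"
  have "adj_mat (Matrix.mat n n (\<lambda>(i, j). A \<omega> i j)) $$ (i, j)
      = (-1)^(j + i) * Determinant.det (Matrix.mat (n - 1) (n - 1) (\<lambda>(a, b). ?f \<omega> a b))" for \<omega>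
    using ij unfolding adj_mat_def cofactor_def mat_delete_def
    by (auto intro!: arg_cong[of _ _ Determinant.det] cong_mat)
  moreover have "(\<lambda>\<omega>. (-1)^(j + i) * Determinant.det (Matrix.mat (n - 1) (n - 1) (\<lambda>(a, b). ?f \<omega> a b))) \<in> borel_measurable N"
    by (intro borel_measurable_times borel_measurable_const measurable_det A) auto
  ultimately show ?thesis unfolding adj_inv_def
    by (intro borel_measurable_divide measurable_det A) auto
qed

lemma minv_eq_adj_inv:
  assumes "is_inv n A (adj_inv n A)" "i < n" "j < n"
  shows "minv n A i j = adj_inv n A i j"
  using is_inv_unique[OF minv_is_inv[OF assms(1)] assms] .

section \<open>Gram matrices and their rank-one updates\<close>

lemma dot_gram: "dot n u (mv n (mmul m (mtr X) X) v) = dot m (mv n X u) (mv n X v)"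
  by (simp add: mv_mmul dot_mv)

lemma full_col_rank_mv:
  "full_col_rank m n X \<longleftrightarrow> (\<forall>v. (\<forall>i<m. mv n X v i = 0) \<longrightarrow> (\<forall>j<n. v j = 0))"
  unfolding full_col_rank_def mv_def ..

text \<open>Pairing the equation with \<open>v\<close> gives
  \<open>|Xv|\<^sup>2 + t (a'v)\<^sup>2 = 0\<close>, a sum of nonnegative terms. Used with
  \<open>t = 0\<close> for the Gram matrix itself and with positive \<open>t\<close> for
  \<open>Sbar\<close>.\<close>

lemma gram_update_inj:
  assumes r: "full_col_rank m n X" and t: "0 \<le> t"
    and 0: "\<And>i. i < n \<Longrightarrow> mv n (mmul m (mtr X) X) v i + t * a i * dot n a v = 0" and j: "j < n"
  shows "v j = 0"
proof -
  have "dot m (mv n X v) (mv n X v) + (t * dot n a v) * dot n v a = 0"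
    using 0 by (subst dot_gram[symmetric], subst dot_lin_right[symmetric], intro dot_zero) (simp add: mult_ac)
  moreover have "0 \<le> (t * dot n a v) * dot n v a"
    using t by (simp add: dot_commute[of n v] mult.assoc)
  ultimately have "dot m (mv n X v) (mv n X v) = 0"
    using dot_nonneg[of m "mv n X v"] by linarith
  then show ?thesis using r j dot_self_zero unfolding full_col_rank_mv by blast
qed

lemma adj_inv_gram:
  assumes "full_col_rank m n X"
  shows "is_inv n (mmul m (mtr X) X) (adj_inv n (mmul m (mtr X) X))"
  using gram_update_inj[OF assms, of 0] by (intro adj_inv_is_inv) simp

lemmas minv_gram = minv_is_inv[OF adj_inv_gram]

lemma mv_rank_one_update: "mv n (\<lambda>i j. A i j + t * a i * a j) v i = mv n A v i + t * a i * dot n a v"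
  unfolding mv_def dot_def by (simp add: algebra_simps sum.distrib sum_distrib_left)

text \<open>Turns the normalised form in the assumption on \<open>\<alpha>\<close> into
  \<open>T * a0\<close>.\<close>

lemma qform_minv_scale:
  assumes A: "is_inv n A B" and c: "c \<noteq> 0"
  shows "qform n (minv n (\<lambda>i j. A i j / c)) v = c * qform n (minv n A) v"
proof -
  have mvA: "mv n (\<lambda>i j. A i j / c) x = (\<lambda>i. mv n A x i / c)" for x
    unfolding mv_def by (simp add: sum_divide_distrib)
  have "is_inv n (\<lambda>i j. A i j / c) (\<lambda>i j. c * B i j)"
    using A c unfolding is_inv_def mmul_def by simp
  then have inv: "is_inv n (\<lambda>i j. A i j / c) (minv n (\<lambda>i j. A i j / c))" by (rule minv_is_inv)
  have "mv n (minv n (\<lambda>i j. A i j / c)) v i = c * mv n (minv n A) v i" if "i < n" for i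
    by (rule is_inv_solve[OF inv _ that])
      (use c is_inv_mv(1)[OF minv_is_inv[OF A]] in \<open>simp add: mvA mv_scale\<close>)
  then have "dot n v (mv n (minv n (\<lambda>i j. A i j / c)) v) = dot n v (\<lambda>i. 0 + c * mv n (minv n A) v i)"
    by (intro dot_cong) auto
  then show ?thesis unfolding qform_dot dot_lin_right by (simp add: dot_zero)
qed

lemma qform_minv_gram:
  assumes "full_col_rank m n X"
  shows "qform n (minv n (mmul m (mtr X) X)) a
    = dot m (mv n X (mv n (minv n (mmul m (mtr X) X)) a)) (mv n X (mv n (minv n (mmul m (mtr X) X)) a))"
  unfolding qform_dot dot_gram[symmetric]
  using is_inv_mv(1)[OF minv_gram[OF assms]] by (subst dot_commute) (intro dot_cong; simp)

text \<open>Sherman-Morrison for the one vector that matters: the update maps every vector into the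
  span of \<open>a\<close>, so the solution for right-hand side \<open>a\<close> is only
  rescaled.\<close>

lemma qform_minv_rank_one_update:
  assumes r: "full_col_rank m n X" and t: "0 \<le> t"
  defines "A \<equiv> mmul m (mtr X) X"
  shows "qform n (minv n (\<lambda>i j. A i j + t * a i * a j)) a
    = qform n (minv n A) a / (1 + t * qform n (minv n A) a)"
proof -
  let ?S = "\<lambda>i j. A i j + t * a i * a j"
  let ?q = "qform n (minv n A) a"
  have q: "0 \<le> ?q" unfolding A_def qform_minv_gram[OF r] by (rule dot_nonneg)
  then have q1: "1 + t * ?q > 0" using t by (simp add: add_pos_nonneg)
  have "is_inv n ?S (adj_inv n ?S)"
    by (intro adj_inv_is_inv gram_update_inj[OF r t]) (auto simp: mv_rank_one_update A_def)
  then have inv: "is_inv n ?S (minv n ?S)" by (rule minv_is_inv)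
  have "mv n (minv n ?S) a i = (1 / (1 + t * ?q)) * mv n (minv n A) a i" if i: "i < n" for i
  proof (rule is_inv_solve[OF inv _ i])
    fix i assume i: "i < n"
    have A1: "mv n A (mv n (minv n A) a) i = a i"
      unfolding A_def by (rule is_inv_mv(1)[OF minv_gram[OF r] i])
    have "mv n ?S (\<lambda>i. (1 / (1 + t * ?q)) * mv n (minv n A) a i) i
      = (1 / (1 + t * ?q)) * (mv n A (mv n (minv n A) a) i + t * a i * dot n a (mv n (minv n A) a))"
      unfolding mv_scale mv_rank_one_update by simp
    also have "\<dots> = a i" unfolding A1 qform_dot[symmetric] using q1 by (simp add: field_simps)
    finally show "mv n ?S (\<lambda>i. (1 / (1 + t * ?q)) * mv n (minv n A) a i) i = a i" .
  qed
  then have "dot n a (mv n (minv n ?S) a) = dot n a (\<lambda>i. 0 + (1 / (1 + t * ?q)) * mv n (minv n A) a i)"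
    by (intro dot_cong) auto
  then show ?thesis unfolding qform_dot dot_lin_right by (simp add: dot_zero)
qed

section \<open>Least-squares residuals\<close>

definition ols :: "nat \<Rightarrow> nat \<Rightarrow> (nat \<Rightarrow> nat \<Rightarrow> real) \<Rightarrow> (nat \<Rightarrow> real) \<Rightarrow> nat \<Rightarrow> real" where
  "ols m n X u = mv n (minv n (mmul m (mtr X) X)) (mv m (mtr X) u)"

lemma resid_maker_mv:
  assumes "i < m"
  shows "mv m (resid_maker m n X) u i = u i + (-1) * mv n X (ols m n X u) i"
proof -
  let ?P = "mmul n (mmul n X (minv n (mmul m (mtr X) X))) (mtr X)"
  have "mv m (resid_maker m n X) u i = mv m midt u i - mv m ?P u i"
    unfolding resid_maker_def mv_def by (simp add: algebra_simps sum_subtractf)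
  then show ?thesis using assms by (simp add: mv_midt mv_mmul ols_def)
qed

lemma resid_maker_orth:
  assumes r: "full_col_rank m n X" and j: "j < n"
  shows "mv m (mtr X) (mv m (resid_maker m n X) u) j = 0"
proof -
  have "mv m (mtr X) (mv m (resid_maker m n X) u) j
      = mv m (mtr X) (\<lambda>i. u i + (-1) * mv n X (ols m n X u) i) j"
    by (intro fun_cong[OF mv_cong] resid_maker_mv)
  also have "\<dots> = mv m (mtr X) u j + (-1) * mv n (mmul m (mtr X) X) (ols m n X u) j"
    unfolding mv_lin mv_mmul ..
  also have "\<dots> = 0"
    unfolding ols_def by (simp add: is_inv_mv(1)[OF minv_gram[OF r] j])
  finally show ?thesis .
qed

lemma dot_resid_maker_orth:
  assumes r: "full_col_rank m n X"
  shows "dot m (mv n X v) (mv m (resid_maker m n X) u) = 0"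
  unfolding dot_mv_left by (intro dot_zero resid_maker_orth[OF r])

lemma dot_resid_maker:
  assumes r: "full_col_rank m n X"
  shows "dot m u (mv m (resid_maker m n X) v)
    = dot m (mv m (resid_maker m n X) u) (mv m (resid_maker m n X) v)"
proof -
  have "dot m (mv m (resid_maker m n X) u) (mv m (resid_maker m n X) v)
      = dot m (\<lambda>i. u i + (-1) * mv n X (ols m n X u) i) (mv m (resid_maker m n X) v)"
    by (intro dot_cong resid_maker_mv) auto
  also have "\<dots> = dot m u (mv m (resid_maker m n X) v)"
    unfolding dot_lin dot_resid_maker_orth[OF r] by simp
  finally show ?thesis ..
qed

text \<open>A residual is characterised by orthogonality, so a guessed decomposition can be verified
  without inverting the Gram matrix of the perturbed regressors.\<close>

lemma resid_maker_unique:
  assumes r: "full_col_rank m n X"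
    and u: "\<And>i. i < m \<Longrightarrow> u i = mv n X v i + w i"
    and w: "\<And>j. j < n \<Longrightarrow> mv m (mtr X) w j = 0"
    and i: "i < m"
  shows "mv m (resid_maker m n X) u i = w i"
proof -
  have "mv m (mtr X) u = mv m (mtr X) (\<lambda>i. mv n X v i + 1 * w i)"
    using u by (intro mv_cong) simp
  also have "\<dots> = (\<lambda>j. mv n (mmul m (mtr X) X) v j + 1 * mv m (mtr X) w j)"
    by (simp only: mv_lin mv_mmul)
  finally have "mv n (mmul m (mtr X) X) v j = mv m (mtr X) u j" if "j < n" for j
    using w[OF that] by simp
  then have "ols m n X u j = v j" if "j < n" for j
    unfolding ols_def using is_inv_solve[OF minv_gram[OF r]] that by blast
  then have "mv n X (ols m n X u) = mv n X v" by (intro mv_cong)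
  then show ?thesis using u[OF i] by (simp add: resid_maker_mv[OF i])
qed

text \<open>Symmetry and idempotence tested on unit vectors; the case \<open>i = j\<close> evaluates
  the column norms.\<close>

lemma resid_maker_entries:
  assumes r: "full_col_rank m n X" and i: "i < m" and j: "j < m"
  shows "(\<Sum>l<m. resid_maker m n X l i * resid_maker m n X l j) = resid_maker m n X i j"
  using dot_resid_maker[OF r, of "\<lambda>k. midt k i" "\<lambda>k. midt k j"] i j
  by (simp add: mv_midt_column dot_midt) (simp add: dot_def)

text \<open>Cyclicity of the trace: exchanging the sums turns the trace of the projection, of size
  \<open>m\<close>, into that of the inverse times the Gram matrix, an identity of size
  \<open>n\<close>.\<close>

lemma resid_maker_trace:
  assumes r: "full_col_rank m n X"
  shows "(\<Sum>i<m. resid_maker m n X i i) = real m - real n"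
proof -
  let ?B = "minv n (mmul m (mtr X) X)"
  have "(\<Sum>i<m. mmul n (mmul n X ?B) (mtr X) i i) = (\<Sum>i<m. \<Sum>b<n. \<Sum>a<n. X i a * ?B a b * X i b)"
    unfolding mmul_def[of n "mmul n X ?B"] by (simp add: mmul_def[of n X] mtr_def sum_distrib_right)
  also have "\<dots> = (\<Sum>b<n. \<Sum>a<n. \<Sum>i<m. X i a * ?B a b * X i b)"
    by (subst sum.swap) (intro sum.cong refl sum.swap)
  also have "\<dots> = (\<Sum>a<n. \<Sum>b<n. \<Sum>i<m. X i a * ?B a b * X i b)" by (rule sum.swap)
  also have "\<dots> = (\<Sum>a<n. mmul n ?B (mmul m (mtr X) X) a a)"
    unfolding mmul_def[of n ?B] by (simp add: mmul_def[of m] mtr_def sum_distrib_left sum_distrib_right mult_ac)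
  also have "\<dots> = real n"
    using minv_gram[OF r] unfolding is_inv_def midt_def by simp
  finally show ?thesis
    unfolding resid_maker_def by (simp add: sum_subtractf midt_def)
qed

lemma dot_minv_gram:
  assumes r: "full_col_rank m n X"
  defines "B \<equiv> minv n (mmul m (mtr X) X)"
  shows "dot n x (mv n B y) = dot n (mv n B x) y"
proof -
  let ?A = "mmul m (mtr X) X"
  note inv = is_inv_mv(1)[OF minv_gram[OF r], folded B_def]
  have "dot n x (mv n B y) = dot n (mv n ?A (mv n B x)) (mv n B y)"
    using inv by (intro dot_cong) auto
  also have "\<dots> = dot n (mv n B x) (mv n ?A (mv n B y))"
    by (subst dot_commute) (simp only: dot_gram dot_commute)
  also have "\<dots> = dot n (mv n B x) y"
    using inv by (intro dot_cong) auto
  finally show ?thesis .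
qed

lemma dot_ols:
  assumes r: "full_col_rank m n X"
  shows "dot n a (ols m n X u) = dot m (mv n X (mv n (minv n (mmul m (mtr X) X)) a)) u"
  unfolding ols_def dot_minv_gram[OF r] dot_mv_left ..

text \<open>Eliminating the span of \<open>Xt\<close> first turns the least-squares problem for \<open>X\<close> into a quadratic
  in the scalar \<open>s\<close>, the coefficient of \<open>e\<close>; \<open>l\<close> is the multiplier of the
  constraint \<open>\<alpha>'v = s\<close>.\<close>

lemma resid_maker_rank_one_update:
  fixes m n :: nat and Xt :: "nat \<Rightarrow> nat \<Rightarrow> real" and al e u :: "nat \<Rightarrow> real"
  defines "X \<equiv> \<lambda>i j. Xt i j + al j * e i"
    and "R \<equiv> resid_maker m n Xt"
    and "q \<equiv> qform n (minv n (mmul m (mtr Xt) Xt)) al"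
    and "d \<equiv> mv n Xt (mv n (minv n (mmul m (mtr Xt) Xt)) al)"
  defines "W \<equiv> dot m e (mv m R e)" and "D \<equiv> dot m e (mv m R u)" and "U \<equiv> dot m u (mv m R u)"
    and "hu \<equiv> dot m d u" and "g \<equiv> 1 + dot m d e"
  assumes r: "full_col_rank m n Xt" and W: "W > 0"
    and y: "\<And>i. i < m \<Longrightarrow> y i = mv n X be i + u i"
  shows "qform m (resid_maker m n X) y
    = U + (W * hu\<^sup>2 - 2 * D * g * hu - q * D\<^sup>2) / (q * W + g\<^sup>2)"
proof -
  let ?B = "minv n (mmul m (mtr Xt) Xt)"
  have q_dot: "q = dot m d d" unfolding q_def d_def by (rule qform_minv_gram[OF r])
  have q0: "0 \<le> q" unfolding q_dot by (rule dot_nonneg)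
  have mvX: "mv n X v = (\<lambda>i. mv n Xt v i + dot n al v * e i)" for v
    unfolding X_def mv_def dot_def by (simp add: algebra_simps sum.distrib sum_distrib_left)
  have mvXt: "mv m (mtr X) w j = mv m (mtr Xt) w j + al j * dot m e w" for w j
    unfolding X_def mv_def dot_def mtr_def by (simp add: algebra_simps sum.distrib sum_distrib_left)
  have R_orth: "mv m (mtr Xt) (mv m R w) j = 0" if "j < n" for w j
    unfolding R_def by (rule resid_maker_orth[OF r that])
  have Re: "dot m (mv n Xt v) (mv m R w) = 0" for v w
    unfolding R_def by (rule dot_resid_maker_orth[OF r])
  \<comment> \<open>Without \<open>W > 0\<close> the Gram matrix of \<open>X\<close> may be singular, and then \<open>minv\<close> is the zero matrix.\<close>
  have rankX: "full_col_rank m n X"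
    unfolding full_col_rank_mv
  proof (intro allI impI)
    fix v j assume 0: "\<forall>i<m. mv n X v i = 0" and j: "j < n"
    \<comment> \<open>\<open>R e\<close> is orthogonal to the columns of \<open>Xt\<close>, so this
      pairing isolates the coefficient of \<open>e\<close>.\<close>
    have "0 = dot m (mv n X v) (mv m R e)"
      using 0 by (subst dot_commute) (simp add: dot_zero)
    also have "\<dots> = dot n al v * W" unfolding mvX dot_lin Re W_def by simp
    finally have "dot n al v = 0" using W by simp
    with 0 have "\<forall>i<m. mv n Xt v i = 0" unfolding mvX by simp
    with r j show "v j = 0" unfolding full_col_rank_mv by blast
  qed
  define De where "De = q * W + g\<^sup>2"
  have De: "De > 0"
  \<comment> \<open>\<open>q\<close> is the squared length of \<open>d\<close>; if it vanishes then
    \<open>d\<close> does too, so \<open>g = 1\<close> and \<open>De\<close> stays positive.\<close>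
  proof (cases "q = 0")
    case True
    then have "dot m d e = 0"
      using dot_self_zero[of m d] unfolding q_dot by (subst dot_commute) (simp add: dot_zero)
    then show ?thesis unfolding De_def g_def True by simp
  next
    case False
    then show ?thesis unfolding De_def using q0 W by (simp add: add_pos_nonneg)
  qed
  \<comment> \<open>Cramer's rule for the two equations \<open>sl\<close> below, whose determinant
    is \<open>-De\<close>. The first will say \<open>e'w = l\<close>, the second
    \<open>al'v = s\<close>.\<close>
  define s where "s = (q * D + hu * g) / De"
  define l where "l = (g * D - hu * W) / De"
  have sDe: "s * De = q * D + hu * g" and lDe: "l * De = g * D - hu * W"
    unfolding s_def l_def using De by simp_all
  have sl: "l * g + s * W = D" "s * g - l * q = hu"
  proof -
    have "(l * g + s * W) * De = (l * De) * g + (s * De) * W" by (simp add: algebra_simps)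
    also have "\<dots> = D * De" unfolding sDe lDe by (simp add: De_def power2_eq_square algebra_simps)
    finally show "l * g + s * W = D" using De by simp
    have "(s * g - l * q) * De = (s * De) * g - (l * De) * q" by (simp add: algebra_simps)
    also have "\<dots> = hu * De" unfolding sDe lDe by (simp add: De_def power2_eq_square algebra_simps)
    finally show "s * g - l * q = hu" using De by simp
  qed
  \<comment> \<open>\<open>v\<close> regresses \<open>u - s e\<close> on \<open>Xt\<close> and
    corrects along \<open>?B al\<close>; \<open>w\<close> is what \<open>mv n X v\<close> leaves of
    \<open>u\<close>.\<close>
  define v where "v = (\<lambda>j. (ols m n Xt u j + (-s) * ols m n Xt e j) + l * mv n ?B al j)"
  define w where "w = (\<lambda>i. (mv m R u i + (-s) * mv m R e i) + (-l) * d i)"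
  have al_v: "dot n al v = s"
    unfolding v_def dot_lin_right dot_ols[OF r] qform_dot[symmetric]
    using sl(2) by (simp add: q_def[symmetric] d_def[symmetric] hu_def[symmetric] g_def algebra_simps)
  have dw: "dot m e w = l"
  proof -
    have "dot m e w = D - s * W - l * dot m d e"
      unfolding w_def dot_lin_right D_def W_def by (simp add: dot_commute)
    then show ?thesis using sl(1) by (simp add: g_def algebra_simps)
  qed
  have uvw: "u i = mv n X v i + w i" if "i < m" for i
    unfolding mvX al_v using that unfolding v_def w_def mv_lin R_def resid_maker_mv[OF that]
    by (simp add: d_def algebra_simps)
  have Xw: "mv m (mtr X) w j = 0" if "j < n" for j
  proof -
    \<comment> \<open>Against \<open>Xt\<close> the residual \<open>w\<close> leaves
      \<open>-l al\<close>, from its term in \<open>d\<close>; the rank-one part of \<open>X\<close>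
      contributes \<open>al\<close> times \<open>e'w = l\<close> and cancels it.\<close>
    have "mv m (mtr Xt) d j = al j"
      unfolding d_def by (simp add: mv_mmul[of n m "mtr Xt" Xt, symmetric] is_inv_mv(1)[OF minv_gram[OF r] that])
    then have "mv m (mtr Xt) w j = - l * al j"
      unfolding w_def mv_lin by (simp add: R_orth[OF that])
    then show ?thesis unfolding mvXt dw by simp
  qed
  have Xw0: "dot m (mv n X x) w = 0" for x
    unfolding dot_mv_left by (intro dot_zero Xw)
  have "mv m (resid_maker m n X) y i = w i" if "i < m" for i
  proof (rule resid_maker_unique[OF rankX _ Xw that])
    show "y i = mv n X (\<lambda>j. be j + 1 * v j) i + w i" if "i < m" for i
      unfolding mv_lin using y[OF that] uvw[OF that] by simp
  qed
  then have "qform m (resid_maker m n X) y = dot m (\<lambda>i. mv n X be i + 1 * u i) w"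
    unfolding qform_dot using y by (intro dot_cong) auto
  also have "\<dots> = dot m u w" unfolding dot_lin Xw0 by simp
  also have "\<dots> = U - s * D - l * hu"
  proof -
    have "dot m u (mv m R e) = D"
      unfolding D_def R_def
      by (rule trans[OF dot_resid_maker[OF r] trans[OF dot_commute dot_resid_maker[OF r, symmetric]]])
    then show ?thesis unfolding w_def dot_lin_right U_def hu_def by (simp add: dot_commute)
  qed
  also have "\<dots> = U + (W * hu\<^sup>2 - 2 * D * g * hu - q * D\<^sup>2) / De"
  proof -
    have "(- s * D - l * hu) * De = - (s * De) * D - (l * De) * hu" by (simp add: algebra_simps)
    also have "\<dots> = W * hu\<^sup>2 - 2 * D * g * hu - q * D\<^sup>2"
      unfolding sDe lDe by (simp add: power2_eq_square algebra_simps)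
    finally have "- s * D - l * hu = (W * hu\<^sup>2 - 2 * D * g * hu - q * D\<^sup>2) / De"
      using De by (simp add: eq_divide_eq)
    then show ?thesis by simp
  qed
  finally show ?thesis unfolding De_def .
qed

section \<open>Conditionally i.i.d. families\<close>

locale cond_iid_family = prob_space M + finite_measure_subalgebra M F
  for M F :: "'a measure" +
  fixes I :: "'i set" and X :: "'i \<Rightarrow> 'a \<Rightarrow> real"
  assumes iid: "cond_iid M F I X" and finI: "finite I"
    and X: "\<And>j. j \<in> I \<Longrightarrow> X j \<in> borel_measurable M"
begin

text \<open>\<open>others_gen i\<close> is an intersection-stable generator of the \<open>\<sigma>\<close>-algebra \<open>others_alg i\<close> of \<open>F\<close> and
  all \<open>X j\<close> with \<open>j \<noteq> i\<close>. Conditional independence is used only through \<open>cond_exp_others\<close>: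
  given \<open>F\<close>, the other variables do not change the conditional expectation of \<open>f (X i)\<close>.\<close>

definition others_gen :: "'i \<Rightarrow> 'a set set" where
  "others_gen i = {A \<inter> (\<Inter>j\<in>I. X j -` B j \<inter> space M) | A B.
     A \<in> sets F \<and> (\<forall>j\<in>I. B j \<in> sets borel) \<and> B i = UNIV}"

definition others_alg :: "'i \<Rightarrow> 'a measure" where
  "others_alg i = sigma (space M) (others_gen i)"

lemma integrable_indicator: "A \<in> sets M \<Longrightarrow> integrable M (indicator A :: 'a \<Rightarrow> real)"
  by (intro integrable_real_indicator) (auto simp: less_top[symmetric])

lemma integrable_cond_prob: "A \<in> sets M \<Longrightarrow> integrable M (cond_prob M F A)"
  unfolding cond_prob_def by (intro real_cond_exp_int integrable_indicator)

lemma integrable_indicator_mult: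
  fixes f :: "'a \<Rightarrow> real"
  assumes "A \<in> sets M" "integrable M f"
  shows "integrable M (\<lambda>x. indicator A x * f x)" "integrable M (\<lambda>x. f x * indicator A x)"
  using integrable_real_mult_indicator[OF assms] by (auto simp: mult.commute)

context
  fixes i :: 'i
  assumes iI: "i \<in> I"
begin

lemma Inter_meas:
  assumes "\<And>j. j \<in> I \<Longrightarrow> B j \<in> sets borel"
  shows "(\<Inter>j\<in>I. X j -` B j \<inter> space M) \<in> sets M"
  using iI finI X assms by (intro sets.finite_INT) (auto intro: measurable_sets)

lemma space_F: "space F = space M" and sets_F: "A \<in> sets F \<Longrightarrow> A \<in> sets M"
  using subalg by (auto simp: subalgebra_def)

lemma others_gen_sets: "others_gen i \<subseteq> sets M"
proof
  fix D assume "D \<in> others_gen i"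
  then obtain A B where D: "D = A \<inter> (\<Inter>j\<in>I. X j -` B j \<inter> space M)" "A \<in> sets F"
    "\<forall>j\<in>I. B j \<in> sets borel"
    unfolding others_gen_def by blast
  show "D \<in> sets M" unfolding D(1) using D(3) by (intro sets.Int sets_F[OF D(2)] Inter_meas) simp
qed

lemma others_gen_Pow: "others_gen i \<subseteq> Pow (space M)"
  using others_gen_sets sets.sets_into_space by blast

lemma others_subalg: "subalgebra M (others_alg i)"
  unfolding others_alg_def subalgebra_def
  using others_gen_Pow sets.sigma_sets_subset[OF others_gen_sets] by (simp add: sets_measure_of)

lemma space_others: "space (others_alg i) = space M"
  unfolding others_alg_def using others_gen_Pow by (simp add: space_measure_of)

lemma sets_others: "sets (others_alg i) = sigma_sets (space M) (others_gen i)"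
  unfolding others_alg_def using others_gen_Pow by simp

lemma F_le_others: "subalgebra (others_alg i) F"
proof -
  have "A \<in> (others_gen i)" if "A \<in> sets F" for A
    unfolding others_gen_def using that iI sets.sets_into_space[OF that] space_F
    by (auto intro!: exI[of _ A] exI[of _ "\<lambda>_. UNIV"])
  then show ?thesis unfolding subalgebra_def sets_others
    by (auto simp: space_others space_F)
qed

lemma X_others:
  assumes j: "j \<in> I" "j \<noteq> i"
  shows "X j \<in> borel_measurable (others_alg i)"
proof (rule measurableI)
  show "\<And>x. x \<in> space (others_alg i) \<Longrightarrow> X j x \<in> space borel" by auto
  fix B :: "real set" assume B: "B \<in> sets borel"
  have "X j -` B \<inter> space M \<in> (others_gen i)"
    unfolding others_gen_def using B j sets.top[of F] space_F
    by (auto intro!: exI[of _ "space M"] exI[of _ "(\<lambda>_. UNIV)(j := B)"] split: if_splits)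
  then show "X j -` B \<inter> space (others_alg i) \<in> sets (others_alg i)"
    unfolding sets_others by (simp add: space_others sigma_sets.Basic)
qed

lemma others_gen_Int_stable: "Int_stable (others_gen i)"
proof (rule Int_stableI)
  fix a b assume "a \<in> (others_gen i)" "b \<in> (others_gen i)"
  then obtain A B A' B' where
    a: "a = A \<inter> (\<Inter>j\<in>I. X j -` B j \<inter> space M)" "A \<in> sets F" "\<forall>j\<in>I. B j \<in> sets borel" "B i = UNIV"
    and b: "b = A' \<inter> (\<Inter>j\<in>I. X j -` B' j \<inter> space M)" "A' \<in> sets F" "\<forall>j\<in>I. B' j \<in> sets borel" "B' i = UNIV"
    unfolding others_gen_def by blast
  have "a \<inter> b = (A \<inter> A') \<inter> (\<Inter>j\<in>I. X j -` (B j \<inter> B' j) \<inter> space M)"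
    unfolding a b by auto
  then show "a \<inter> b \<in> (others_gen i)"
    unfolding others_gen_def using a(2-) b(2-)
    by (intro CollectI exI[of _ "A \<inter> A'"] exI[of _ "\<lambda>j. B j \<inter> B' j"]) auto
qed

lemma cond_prob_bounds:
  assumes A: "A \<in> sets M"
  shows "AE \<omega> in M. 0 \<le> cond_prob M F A \<omega>" "AE \<omega> in M. cond_prob M F A \<omega> \<le> 1"
  unfolding cond_prob_def using A integrable_indicator[OF A]
  by (auto intro!: real_cond_exp_pos real_cond_exp_le_c simp: indicator_le_1)

lemma cond_prob_meas [measurable]: "cond_prob M F A \<in> borel_measurable F"
  unfolding cond_prob_def by simp

lemma cond_prob_measM [measurable]: "cond_prob M F A \<in> borel_measurable M"
  by (rule measurable_from_subalg[OF subalg]) simp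

lemma cond_prob_space: "AE \<omega> in M. cond_prob M F (space M) \<omega> = 1"
proof -
  have "AE \<omega> in M. real_cond_exp M F (\<lambda>_. 1) \<omega> = 1"
    by (intro real_cond_exp_F_meas) auto
  moreover have "AE \<omega> in M. real_cond_exp M F (indicator (space M)) \<omega> = real_cond_exp M F (\<lambda>_. 1) \<omega>"
    by (intro real_cond_exp_cong) (auto simp: AE_I2)
  ultimately show ?thesis unfolding cond_prob_def by eventually_elim simp
qed

text \<open>Independence gives the claim on the intersection-stable generator, and the sets
  \<open>D\<close> with vanishing integral form a Dynkin system.\<close>

lemma cond_prob_set_integral:
  assumes A: "A \<in> sets M" and D: "D \<in> sets (others_alg i)" and A_def: "A = X i -` B \<inter> space M"
    and B: "B \<in> sets borel"
  shows "(LINT \<omega>:D|M. indicator A \<omega> - cond_prob M F A \<omega>) = 0"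
proof -
  let ?g = "\<lambda>\<omega>. indicator A \<omega> - cond_prob M F A \<omega> :: real"
  have [measurable]: "A \<in> sets M" by fact
  have int_p: "integrable M (cond_prob M F A)"
    by (rule integrable_cond_prob) simp
  have int_g: "integrable M ?g"
    using int_p by (intro Bochner_Integration.integrable_diff integrable_indicator) auto
  have sets_oM: "D \<in> sets M" if "D \<in> sets (others_alg i)" for D
    using others_subalg that by (auto simp: subalgebra_def)
  have set_int: "set_integrable M D ?g" if "D \<in> sets M" for D
    unfolding set_integrable_def using int_g that by (intro integrable_mult_indicator)
  have g0: "(LINT \<omega>|M. ?g \<omega>) = 0"
  proof -
    have "(LINT \<omega>|M. cond_prob M F A \<omega>) = (LINT \<omega>|M. indicator A \<omega>)"
      unfolding cond_prob_def by (rule real_cond_exp_int(2)[OF integrable_indicator]) simp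
    then show ?thesis using int_p integrable_indicator[of A] by simp
  qed
  have "D \<in> sigma_sets (space M) (others_gen i)" using D sets_others by simp
  with others_gen_Int_stable others_gen_Pow show ?thesis
  proof (induction rule: sigma_sets_induct_disjoint)
    case (basic D)
    then obtain E Bs where D_eq: "D = E \<inter> (\<Inter>j\<in>I. X j -` Bs j \<inter> space M)"
      and E: "E \<in> sets F" and Bs: "\<forall>j\<in>I. Bs j \<in> sets borel" "Bs i = UNIV"
      unfolding others_gen_def by blast
    let ?J = "\<Inter>j\<in>I. X j -` Bs j \<inter> space M"
    \<comment> \<open>The generator leaves slot \<open>i\<close> free (\<open>Bs i = UNIV\<close>);
      putting \<open>B\<close> there turns \<open>?J\<close> into
      \<open>?J \<inter> A\<close>.\<close>
    let ?Bs' = "Bs(i := B)"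
    let ?J' = "\<Inter>j\<in>I. X j -` ?Bs' j \<inter> space M"
    have [measurable]: "E \<in> sets F" "?J \<in> sets M" "?J' \<in> sets M" "E \<in> sets M"
      using E Bs B Inter_meas[of Bs] Inter_meas[of ?Bs'] sets_F by auto
    have J': "?J' = ?J \<inter> A" using iI Bs unfolding A_def by (auto split: if_splits)
    have e1: "AE \<omega> in M. cond_prob M F ?J' \<omega> = (\<Prod>j\<in>I. cond_prob M F (X j -` ?Bs' j \<inter> space M) \<omega>)"
      using iid B Bs unfolding cond_iid_def by (simp only: fun_upd_apply) auto
    have e2: "AE \<omega> in M. cond_prob M F ?J \<omega> = (\<Prod>j\<in>I. cond_prob M F (X j -` Bs j \<inter> space M) \<omega>)"
      using iid B Bs unfolding cond_iid_def by auto
    \<comment> \<open>In the product for \<open>?J\<close> the factor at \<open>i\<close> is the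
      conditional probability of the whole space, hence 1; so the two products differ exactly by the
      factor of \<open>A\<close>.\<close>
    have e3: "AE \<omega> in M. cond_prob M F ?J' \<omega> = cond_prob M F A \<omega> * cond_prob M F ?J \<omega>"
      using e1 e2 cond_prob_space
    proof eventually_elim
      case (elim \<omega>)
      have "cond_prob M F ?J' \<omega> = (\<Prod>j\<in>insert i (I-{i}). cond_prob M F (X j -` ?Bs' j \<inter> space M) \<omega>)"
        using elim(1) iI by (simp add: insert_absorb)
      also have "\<dots> = cond_prob M F A \<omega> * (\<Prod>j\<in>I-{i}. cond_prob M F (X j -` Bs j \<inter> space M) \<omega>)"
        using finI by (subst prod.insert) (auto simp: A_def intro!: prod.cong)
      finally have l: "cond_prob M F ?J' \<omega> = \<dots>" .
      have "cond_prob M F ?J \<omega> = (\<Prod>j\<in>insert i (I-{i}). cond_prob M F (X j -` Bs j \<inter> space M) \<omega>)"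
        using elim(2) iI by (simp add: insert_absorb)
      also have "\<dots> = (\<Prod>j\<in>I-{i}. cond_prob M F (X j -` Bs j \<inter> space M) \<omega>)"
        using finI elim(3) Bs(2) by (subst prod.insert) auto
      finally show ?case using l by simp
    qed
    have "(LINT \<omega>:D|M. indicator A \<omega>) = (LINT \<omega>|M. indicator E \<omega> * indicator ?J' \<omega> :: real)"
      unfolding set_lebesgue_integral_def J' D_eq
      by (intro Bochner_Integration.integral_cong) (auto simp: indicator_def)
    also have "\<dots> = (LINT \<omega>|M. indicator E \<omega> * cond_prob M F ?J' \<omega>)"
      unfolding cond_prob_def
      by (intro real_cond_exp_intg(2)[symmetric] integrable_indicator_mult integrable_indicator
        borel_measurable_indicator) fact+
    also have "\<dots> = (LINT \<omega>|M. (indicator E \<omega> * cond_prob M F A \<omega>) * cond_prob M F ?J \<omega>)"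
    proof (rule integral_cong_AE)
      show "AE \<omega> in M. indicator E \<omega> * cond_prob M F ?J' \<omega> = (indicator E \<omega> * cond_prob M F A \<omega>) * cond_prob M F ?J \<omega>"
        using e3 by eventually_elim (simp add: mult.assoc)
    qed measurable
    \<comment> \<open>The factor in front is \<open>F\<close>-measurable, so the conditioning of
      \<open>?J\<close> can be undone.\<close>
    also have "\<dots> = (LINT \<omega>|M. (indicator E \<omega> * cond_prob M F A \<omega>) * indicator ?J \<omega>)"
      unfolding cond_prob_def[of M F ?J]
      by (intro real_cond_exp_intg(2) integrable_indicator_mult borel_measurable_times
        borel_measurable_indicator cond_prob_meas) fact+
    also have "\<dots> = (LINT \<omega>:D|M. cond_prob M F A \<omega>)"
      unfolding set_lebesgue_integral_def D_eq
      by (intro Bochner_Integration.integral_cong) (auto simp: indicator_def)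
    finally have eq: "(LINT \<omega>:D|M. indicator A \<omega>) = (LINT \<omega>:D|M. cond_prob M F A \<omega>)" .
    have "D \<in> sets M" unfolding D_eq by (intro sets.Int) fact+
    then show ?case using eq int_p
      by (subst set_integral_diff) (auto simp: set_integrable_def intro!: integrable_indicator_mult integrable_indicator)
  next
    case empty then show ?case by (simp add: set_lebesgue_integral_def)
  next
    case (compl D)
    then have D: "D \<in> sets M" using sets_oM sets_others by auto
    have "(LINT \<omega>:space M|M. ?g \<omega>) = (LINT \<omega>:D \<union> (space M - D)|M. ?g \<omega>)"
      using sets.sets_into_space[OF D] by (simp add: Un_absorb1)
    also have "\<dots> = (LINT \<omega>:D|M. ?g \<omega>) + (LINT \<omega>:space M - D|M. ?g \<omega>)"
      using D by (intro set_integral_Un set_int) auto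
    finally show ?case using compl.IH g0 int_g by (simp add: set_integral_space)
  next
    case (union D)
    then have D: "range D \<subseteq> sets M" using sets_oM sets_others by auto
    have "(LINT \<omega>:(\<Union>i. D i)|M. ?g \<omega>) = (\<Sum>i. LINT \<omega>:(D i)|M. ?g \<omega>)"
      using D union.hyps(1) by (intro lebesgue_integral_countable_add set_int) (auto simp: disjoint_family_on_def)
    then show ?case using union.IH by simp
  qed
qed

text \<open>It is enough that, against functions of \<open>X i\<close>, the indicator of
  \<open>D\<close> may be replaced by its conditional probability given \<open>F\<close>. The two
  measures with these densities have the same image under \<open>X i\<close>, which covers every
  Borel \<open>f\<close> at once.\<close>

lemma cond_exp_others:
  assumes f[measurable]: "f \<in> borel_measurable borel" and int: "integrable M (\<lambda>\<omega>. f (X i \<omega>))"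
  shows "AE \<omega> in M. real_cond_exp M (others_alg i) (\<lambda>\<omega>. f (X i \<omega>)) \<omega> = real_cond_exp M F (\<lambda>\<omega>. f (X i \<omega>)) \<omega>"
proof -
  interpret O: finite_measure_subalgebra M "others_alg i" by unfold_locales (rule others_subalg)
  have [measurable]: "X i \<in> borel_measurable M" using X iI by simp
  show ?thesis
  proof (rule O.real_cond_exp_charact)
    show "integrable M (\<lambda>\<omega>. f (X i \<omega>))" by fact
    show "integrable M (real_cond_exp M F (\<lambda>\<omega>. f (X i \<omega>)))" using int by (rule real_cond_exp_int)
    show "real_cond_exp M F (\<lambda>\<omega>. f (X i \<omega>)) \<in> borel_measurable (others_alg i)"
      by (rule measurable_from_subalg[OF F_le_others]) simp
    fix D assume D: "D \<in> sets (others_alg i)"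
    then have DM[measurable]: "D \<in> sets M" using others_subalg by (auto simp: subalgebra_def)
    let ?q = "cond_prob M F D"
    have q0: "AE \<omega> in M. 0 \<le> ?q \<omega>" and q1: "AE \<omega> in M. ?q \<omega> \<le> 1" using cond_prob_bounds[OF DM] by auto
    have int_q: "integrable M ?q"
      by (rule integrable_cond_prob) simp
    \<comment> \<open>Conditioning moves from one factor to the other: both sides equal the integral
      of the product of the two conditional probabilities.\<close>
    have eqB: "(LINT \<omega>|M. indicator D \<omega> * indicator (X i -` B \<inter> space M) \<omega>)
        = (LINT \<omega>|M. ?q \<omega> * indicator (X i -` B \<inter> space M) \<omega>)" if B[measurable]: "B \<in> sets borel" for B
    proof -
      let ?A = "X i -` B \<inter> space M"
      have A[measurable]: "?A \<in> sets M" by measurable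
      have int_p: "integrable M (cond_prob M F ?A)"
        by (rule integrable_cond_prob) simp
      have "(LINT \<omega>:D|M. indicator ?A \<omega>) = (LINT \<omega>:D|M. cond_prob M F ?A \<omega>)"
        using cond_prob_set_integral[OF A D refl B] int_p DM
        by (subst (asm) set_integral_diff) (auto simp: set_integrable_def intro!: integrable_indicator_mult integrable_indicator)
      then have "(LINT \<omega>|M. indicator D \<omega> * indicator ?A \<omega>) = (LINT \<omega>|M. cond_prob M F ?A \<omega> * indicator D \<omega>)"
        by (simp add: set_lebesgue_integral_def mult.commute)
      also have "\<dots> = (LINT \<omega>|M. cond_prob M F ?A \<omega> * ?q \<omega>)"
        unfolding cond_prob_def[of M F D] using int_p
        by (intro real_cond_exp_intg(2)[symmetric]) (auto intro!: integrable_indicator_mult)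
      also have "\<dots> = (LINT \<omega>|M. ?q \<omega> * cond_prob M F ?A \<omega>)" by (simp add: mult.commute)
      also have "\<dots> = (LINT \<omega>|M. ?q \<omega> * indicator ?A \<omega>)"
        unfolding cond_prob_def[of M F ?A] using int_q
        by (intro real_cond_exp_intg(2)) (auto intro!: integrable_indicator_mult)
      finally show ?thesis .
    qed
    let ?N1 = "distr (density M (\<lambda>\<omega>. ennreal (indicator D \<omega>))) borel (X i)"
    let ?N2 = "distr (density M (\<lambda>\<omega>. ennreal (?q \<omega>))) borel (X i)"
    have "?N1 = ?N2"
    proof (rule measure_eqI)
      fix B assume "B \<in> sets ?N1"
      then have B[measurable]: "B \<in> sets borel" by simp
      have "emeasure ?N1 B = (\<integral>\<^sup>+\<omega>. ennreal (indicator D \<omega> * indicator (X i -` B \<inter> space M) \<omega>) \<partial>M)"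
        by (simp add: emeasure_distr emeasure_density, intro nn_integral_cong) (auto simp: indicator_def)
      also have "\<dots> = (\<integral>\<^sup>+\<omega>. ennreal (?q \<omega> * indicator (X i -` B \<inter> space M) \<omega>) \<partial>M)"
        using q0 int_q
        by (subst (1 2) nn_integral_eq_integral) 
          (auto intro!: integrable_indicator_mult integrable_indicator simp: eqB elim!: eventually_mono)
      also have "\<dots> = emeasure ?N2 B"
        by (simp add: emeasure_distr emeasure_density, intro nn_integral_cong) (auto simp: indicator_def)
      finally show "emeasure ?N1 B = emeasure ?N2 B" .
    qed simp
    then have "(LINT x|?N1. f x) = (LINT x|?N2. f x)" by simp
    then have *: "(LINT \<omega>|M. indicator D \<omega> * f (X i \<omega>)) = (LINT \<omega>|M. ?q \<omega> * f (X i \<omega>))"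
      using q0 by (simp add: integral_distr integral_density)
    have int_fp: "integrable M (real_cond_exp M F (\<lambda>\<omega>. f (X i \<omega>)))" using int by (rule real_cond_exp_int)
    have int_qf: "integrable M (\<lambda>\<omega>. ?q \<omega> * f (X i \<omega>))"
      by (rule Bochner_Integration.integrable_bound[OF int]) 
        (use q0 q1 in \<open>auto simp: abs_mult mult_left_le_one_le elim!: eventually_elim2\<close>)
    have "(LINT \<omega>:D|M. f (X i \<omega>)) = (LINT \<omega>|M. ?q \<omega> * f (X i \<omega>))"
      using * by (simp add: set_lebesgue_integral_def)
    also have "\<dots> = (LINT \<omega>|M. ?q \<omega> * real_cond_exp M F (\<lambda>\<omega>. f (X i \<omega>)) \<omega>)"
      using int_qf by (intro real_cond_exp_intg(2)[symmetric]) auto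
    also have "\<dots> = (LINT \<omega>|M. real_cond_exp M F (\<lambda>\<omega>. f (X i \<omega>)) \<omega> * ?q \<omega>)"
      by (simp add: mult.commute)
    also have "\<dots> = (LINT \<omega>|M. real_cond_exp M F (\<lambda>\<omega>. f (X i \<omega>)) \<omega> * indicator D \<omega>)"
      unfolding cond_prob_def using int_fp
      by (intro real_cond_exp_intg(2)) (auto intro!: integrable_indicator_mult)
    finally show "(LINT \<omega>:D|M. f (X i \<omega>)) = (LINT \<omega>:D|M. real_cond_exp M F (\<lambda>\<omega>. f (X i \<omega>)) \<omega>)"
      by (simp add: set_lebesgue_integral_def mult.commute)
  qed
qed

text \<open>The working form: conditional moments given \<open>F\<close> may be inserted even when
  \<open>Y\<close> involves the other errors.\<close>

lemma integral_mult_others: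
  assumes f: "f \<in> borel_measurable borel" and int: "integrable M (\<lambda>\<omega>. f (X i \<omega>))"
    and Y: "Y \<in> borel_measurable (others_alg i)" and intY: "integrable M (\<lambda>\<omega>. Y \<omega> * f (X i \<omega>))"
  shows "(LINT \<omega>|M. Y \<omega> * f (X i \<omega>)) = (LINT \<omega>|M. Y \<omega> * real_cond_exp M F (\<lambda>\<omega>. f (X i \<omega>)) \<omega>)"
proof -
  interpret O: finite_measure_subalgebra M "others_alg i" by unfold_locales (rule others_subalg)
  have [measurable]: "f \<in> borel_measurable borel" "X i \<in> borel_measurable M" "Y \<in> borel_measurable (others_alg i)"
    "Y \<in> borel_measurable M" using f X iI Y measurable_from_subalg[OF others_subalg Y] by auto
  have ae: "AE \<omega> in M. Y \<omega> * real_cond_exp M (others_alg i) (\<lambda>\<omega>. f (X i \<omega>)) \<omega> = Y \<omega> * real_cond_exp M F (\<lambda>\<omega>. f (X i \<omega>)) \<omega>"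
    using cond_exp_others[OF f int] by auto
  have [measurable]: "real_cond_exp M F (\<lambda>\<omega>. f (X i \<omega>)) \<in> borel_measurable M"
    by (rule measurable_from_subalg[OF subalg]) simp
  have [measurable]: "real_cond_exp M (others_alg i) (\<lambda>\<omega>. f (X i \<omega>)) \<in> borel_measurable M"
    by (rule measurable_from_subalg[OF others_subalg]) simp
  have "(LINT \<omega>|M. Y \<omega> * real_cond_exp M F (\<lambda>\<omega>. f (X i \<omega>)) \<omega>) = (LINT \<omega>|M. Y \<omega> * real_cond_exp M (others_alg i) (\<lambda>\<omega>. f (X i \<omega>)) \<omega>)"
    using ae by (intro integral_cong_AE) auto
  also have "\<dots> = (LINT \<omega>|M. Y \<omega> * f (X i \<omega>))"
    using intY by (intro O.real_cond_exp_intg(2)) auto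
  finally show ?thesis by simp
qed

end

end

section \<open>Second moments of sums\<close>

lemma integrable_mult_squares:
  fixes f g :: "'a \<Rightarrow> real"
  assumes "integrable M (\<lambda>x. (f x)\<^sup>2)" "integrable M (\<lambda>x. (g x)\<^sup>2)"
    and [measurable]: "f \<in> borel_measurable M" "g \<in> borel_measurable M"
  shows "integrable M (\<lambda>x. f x * g x)"
proof (rule Bochner_Integration.integrable_bound)
  show "integrable M (\<lambda>x. (f x)\<^sup>2 + (g x)\<^sup>2)" using assms by simp
  show "AE x in M. norm (f x * g x) \<le> norm ((f x)\<^sup>2 + (g x)\<^sup>2)"
  proof (rule AE_I2)
    fix x
    have "0 \<le> (\<bar>f x\<bar> - \<bar>g x\<bar>)\<^sup>2" by simp
    then have "2 * \<bar>f x * g x\<bar> \<le> (f x)\<^sup>2 + (g x)\<^sup>2"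
      by (simp add: abs_mult power2_diff)
    then show "norm (f x * g x) \<le> norm ((f x)\<^sup>2 + (g x)\<^sup>2)"
      using abs_ge_zero[of "f x * g x"] unfolding real_norm_def by linarith
  qed
qed measurable

text \<open>Applied below with \<open>\<tau>\<close> the swap of index pairs, since \<open>\<xi> i j\<close> and \<open>\<xi> k l\<close> are uncorrelated
  unless \<open>{i, j} = {k, l}\<close>.\<close>

lemma integral_sum_squared_le:
  fixes Z :: "'i \<Rightarrow> 'a \<Rightarrow> real"
  assumes fin: "finite A" and \<tau>: "\<And>a. a \<in> A \<Longrightarrow> \<tau> a \<in> A" "\<And>a. a \<in> A \<Longrightarrow> \<tau> (\<tau> a) = a"
    and meas: "\<And>a. a \<in> A \<Longrightarrow> Z a \<in> borel_measurable M"
    and sq: "\<And>a. a \<in> A \<Longrightarrow> integrable M (\<lambda>x. (Z a x)\<^sup>2)"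
    and orth: "\<And>a b. a \<in> A \<Longrightarrow> b \<in> A \<Longrightarrow> b \<noteq> a \<Longrightarrow> b \<noteq> \<tau> a \<Longrightarrow> (LINT x|M. Z a x * Z b x) = 0"
  shows "integrable M (\<lambda>x. (\<Sum>a\<in>A. Z a x)\<^sup>2)"
    "(LINT x|M. (\<Sum>a\<in>A. Z a x)\<^sup>2) \<le> 2 * (\<Sum>a\<in>A. LINT x|M. (Z a x)\<^sup>2)"
proof -
  let ?e = "\<lambda>a. LINT x|M. (Z a x)\<^sup>2"
  have prod: "integrable M (\<lambda>x. Z a x * Z b x)" if "a \<in> A" "b \<in> A" for a b
    using that by (intro integrable_mult_squares sq meas)
  have e0: "0 \<le> ?e a" for a by simp
  have eq: "(\<Sum>a\<in>A. Z a x)\<^sup>2 = (\<Sum>a\<in>A. \<Sum>b\<in>A. Z a x * Z b x)" for x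
    by (simp add: power2_eq_square sum_product)
  show "integrable M (\<lambda>x. (\<Sum>a\<in>A. Z a x)\<^sup>2)"
    unfolding eq by (intro Bochner_Integration.integrable_sum prod)
  \<comment> \<open>Each \<open>a\<close> has at most the partners \<open>a\<close> and
    \<open>\<tau> a\<close>, the latter handled by \<open>2xy \<le> x\<^sup>2 + y\<^sup>2\<close>.
    If \<open>\<tau> a = a\<close> both summands count, which only weakens the bound.\<close>
  have le: "(LINT x|M. Z a x * Z b x) \<le>
      (if b = a then ?e a else 0) + (if b = \<tau> a then (?e a + ?e b) / 2 else 0)"
    if a: "a \<in> A" and b: "b \<in> A" for a b
  proof -
    have "(LINT x|M. Z a x * Z b x) \<le> (LINT x|M. ((Z a x)\<^sup>2 + (Z b x)\<^sup>2) / 2)"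
    proof (rule integral_mono)
      fix x
      have "0 \<le> (Z a x - Z b x)\<^sup>2" by simp
      then show "Z a x * Z b x \<le> ((Z a x)\<^sup>2 + (Z b x)\<^sup>2) / 2" by (simp add: power2_diff)
    qed (use prod[OF a b] sq a b in auto)
    also have "\<dots> = (?e a + ?e b) / 2" using sq a b by simp
    finally have le: "(LINT x|M. Z a x * Z b x) \<le> (?e a + ?e b) / 2" .
    show ?thesis
      using le e0[of a] e0[of b] orth[OF a b] by (auto simp: power2_eq_square)
  qed
  have "(LINT x|M. (\<Sum>a\<in>A. Z a x)\<^sup>2) = (\<Sum>a\<in>A. \<Sum>b\<in>A. LINT x|M. Z a x * Z b x)"
    unfolding eq using prod by (simp add: Bochner_Integration.integral_sum Bochner_Integration.integrable_sum)
  also have "\<dots> \<le> (\<Sum>a\<in>A. \<Sum>b\<in>A. (if b = a then ?e a else 0) + (if b = \<tau> a then (?e a + ?e b) / 2 else 0))"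
    by (intro sum_mono le)
  also have "\<dots> = (\<Sum>a\<in>A. ?e a + (?e a + ?e (\<tau> a)) / 2)"
    using fin \<tau> by (intro sum.cong) (auto simp: sum.distrib)
  also have "\<dots> = (\<Sum>a\<in>A. ?e a) + ((\<Sum>a\<in>A. ?e a) + (\<Sum>a\<in>A. ?e (\<tau> a))) / 2"
    by (simp only: sum.distrib sum_divide_distrib[symmetric])
  also have "(\<Sum>a\<in>A. ?e (\<tau> a)) = (\<Sum>a\<in>A. ?e a)"
    by (rule sum.reindex_bij_witness[of _ \<tau> \<tau>]) (auto simp: \<tau>)
  finally show "(LINT x|M. (\<Sum>a\<in>A. Z a x)\<^sup>2) \<le> 2 * (\<Sum>a\<in>A. ?e a)" by simp
qed

lemma (in prob_space) prob_abs_gt_le: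
  fixes V :: "'a \<Rightarrow> real"
  assumes [measurable]: "V \<in> borel_measurable M" and int: "integrable M (\<lambda>x. (V x)\<^sup>2)" and d: "0 < d"
  shows "measure M {x\<in>space M. \<bar>V x\<bar> > d} \<le> (LINT x|M. (V x)\<^sup>2) / d\<^sup>2"
proof -
  have "measure M {x\<in>space M. \<bar>V x\<bar> > d} \<le> measure M {x\<in>space M. (V x)\<^sup>2 \<ge> d\<^sup>2}"
    using d by (intro finite_measure_mono) (auto simp: abs_le_square_iff[symmetric])
  also have "\<dots> \<le> (LINT x|M. (V x)\<^sup>2) / d\<^sup>2"
    using int d by (intro integral_Markov_inequality_measure[where A="{}"]) auto
  finally show ?thesis .
qed

section \<open>Conditionally centred products of errors\<close>

locale cond_iid_moments = cond_iid_family +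
  fixes s2 :: "'a \<Rightarrow> real" and C :: real
  assumes int4: "\<And>j. j \<in> I \<Longrightarrow> integrable M (\<lambda>\<omega>. X j \<omega> ^ 4)"
    and mean0: "\<And>j. j \<in> I \<Longrightarrow> AE \<omega> in M. real_cond_exp M F (X j) \<omega> = 0"
    and s2_F: "s2 \<in> borel_measurable F"
    and s2_eq: "\<And>j. j \<in> I \<Longrightarrow> AE \<omega> in M. real_cond_exp M F (\<lambda>\<omega>. (X j \<omega>)\<^sup>2) \<omega> = s2 \<omega>"
    and s2_bd: "AE \<omega> in M. 0 \<le> s2 \<omega> \<and> s2 \<omega> \<le> C"
    and m4: "\<And>j. j \<in> I \<Longrightarrow> AE \<omega> in M. real_cond_exp M F (\<lambda>\<omega>. X j \<omega> ^ 4) \<omega> \<le> C"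
begin

text \<open>The product of two errors minus its conditional mean given \<open>F\<close>; for
  distinct indices this mean is zero.\<close>

definition \<xi> :: "'b \<Rightarrow> 'b \<Rightarrow> 'a \<Rightarrow> real" where
  "\<xi> i j \<omega> = X i \<omega> * X j \<omega> - (if i = j then s2 \<omega> else 0)"

lemma F_M: "f \<in> borel_measurable F \<Longrightarrow> f \<in> borel_measurable M"
  by (rule measurable_from_subalg[OF subalg])

lemma F_others: "i \<in> I \<Longrightarrow> f \<in> borel_measurable F \<Longrightarrow> f \<in> borel_measurable (others_alg i)"
  by (rule measurable_from_subalg[OF F_le_others])

lemma s2_M [measurable]: "s2 \<in> borel_measurable M" by (rule F_M[OF s2_F])

lemma C_nonneg: "0 \<le> C"
proof -
  have "AE \<omega> in M. 0 \<le> C" using s2_bd by eventually_elim simp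
  then show ?thesis by simp
qed

lemma \<xi>_M: "i \<in> I \<Longrightarrow> j \<in> I \<Longrightarrow> \<xi> i j \<in> borel_measurable M"
  unfolding \<xi>_def using X by auto

lemma \<xi>_others:
  assumes "p \<in> I" "i \<in> I" "j \<in> I" "i \<noteq> p" "j \<noteq> p"
  shows "\<xi> i j \<in> borel_measurable (others_alg p)"
proof -
  have [measurable]: "X i \<in> borel_measurable (others_alg p)" "X j \<in> borel_measurable (others_alg p)"
    "s2 \<in> borel_measurable (others_alg p)"
    using assms X_others F_others s2_F by auto
  show ?thesis unfolding \<xi>_def by measurable
qed

lemma \<xi>_commute: "\<xi> i j = \<xi> j i"
  unfolding \<xi>_def by (auto simp: mult.commute)

lemma integrable_X:
  assumes j: "j \<in> I"
  shows "integrable M (X j)" "integrable M (\<lambda>\<omega>. (X j \<omega>)\<^sup>2)"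
proof -
  have [measurable]: "X j \<in> borel_measurable M" using X j by auto
  have i: "integrable M (\<lambda>\<omega>. 1 + X j \<omega> ^ 4)" using int4[OF j] by simp
  have b2: "x\<^sup>2 \<le> 1 + x ^ 4" for x :: real
  proof -
    have "0 \<le> (x\<^sup>2 - 1)\<^sup>2" by simp
    then have "2 * x\<^sup>2 \<le> x ^ 4 + 1" by (simp add: power2_diff power_mult[symmetric])
    then show ?thesis using zero_le_power2[of x] by linarith
  qed
  have b1: "\<bar>x\<bar> \<le> 1 + x ^ 4" for x :: real
  proof (cases "\<bar>x\<bar> \<le> 1")
    case True
    then show ?thesis by (simp add: add_increasing2)
  next
    case False
    then have "\<bar>x\<bar> \<le> \<bar>x\<bar>\<^sup>2" by (intro self_le_power) auto
    then show ?thesis using b2[of x] by simp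
  qed
  show "integrable M (\<lambda>\<omega>. (X j \<omega>)\<^sup>2)"
    by (rule Bochner_Integration.integrable_bound[OF i])
      (use b2 in \<open>auto intro!: AE_I2 order_trans[OF b2]\<close>)
  show "integrable M (X j)"
    by (rule Bochner_Integration.integrable_bound[OF i])
      (use b1 in \<open>auto intro!: AE_I2 order_trans[OF b1]\<close>)
qed

lemma integral_mult_X:
  assumes i: "i \<in> I" and Y: "Y \<in> borel_measurable (others_alg i)" and int: "integrable M (\<lambda>\<omega>. Y \<omega> * X i \<omega>)"
  shows "(LINT \<omega>|M. Y \<omega> * X i \<omega>) = 0"
proof -
  have "(LINT \<omega>|M. Y \<omega> * X i \<omega>) = (LINT \<omega>|M. Y \<omega> * real_cond_exp M F (X i) \<omega>)"
    using integral_mult_others[OF i, of "\<lambda>x. x" Y] integrable_X(1)[OF i] Y int by simp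
  also have "\<dots> = (LINT \<omega>|M. 0)"
  proof (rule integral_cong_AE)
    show "AE \<omega> in M. Y \<omega> * real_cond_exp M F (X i) \<omega> = 0"
      using mean0[OF i] by eventually_elim simp
    show "(\<lambda>\<omega>. Y \<omega> * real_cond_exp M F (X i) \<omega>) \<in> borel_measurable M"
      by (intro borel_measurable_times measurable_from_subalg[OF others_subalg[OF i] Y] F_M borel_measurable_cond_exp)
  qed simp
  finally show ?thesis by simp
qed

lemma integrable_s2_squared: "integrable M (\<lambda>\<omega>. (s2 \<omega>)\<^sup>2)"
proof (rule Bochner_Integration.integrable_bound[where f="\<lambda>_. C\<^sup>2"])
  show "AE \<omega> in M. norm ((s2 \<omega>)\<^sup>2) \<le> norm (C\<^sup>2)"
    using s2_bd by eventually_elim (auto intro: power_mono)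
qed auto

lemma integral_mult_\<xi>_diag:
  assumes i: "i \<in> I" and Y: "Y \<in> borel_measurable (others_alg i)" and int: "integrable M (\<lambda>\<omega>. (Y \<omega>)\<^sup>2)"
  shows "(LINT \<omega>|M. Y \<omega> * \<xi> i i \<omega>) = 0"
proof -
  have [measurable]: "Y \<in> borel_measurable M" "X i \<in> borel_measurable M"
    using measurable_from_subalg[OF others_subalg[OF i] Y] X i by auto
  have iX: "integrable M (\<lambda>\<omega>. Y \<omega> * (X i \<omega>)\<^sup>2)"
    using int int4[OF i] by (intro integrable_mult_squares) (auto simp: power_mult[symmetric])
  have iS: "integrable M (\<lambda>\<omega>. Y \<omega> * s2 \<omega>)"
    using int integrable_s2_squared by (intro integrable_mult_squares) auto
  have [measurable]: "real_cond_exp M F (\<lambda>\<omega>. (X i \<omega>)\<^sup>2) \<in> borel_measurable M"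
    by (intro F_M borel_measurable_cond_exp)
  have "(LINT \<omega>|M. Y \<omega> * (X i \<omega>)\<^sup>2) = (LINT \<omega>|M. Y \<omega> * real_cond_exp M F (\<lambda>\<omega>. (X i \<omega>)\<^sup>2) \<omega>)"
    using integral_mult_others[OF i, of "\<lambda>x. x\<^sup>2" Y] integrable_X(2)[OF i] Y iX by simp
  also have "\<dots> = (LINT \<omega>|M. Y \<omega> * s2 \<omega>)"
    using s2_eq[OF i] by (intro integral_cong_AE) auto
  finally have "(LINT \<omega>|M. Y \<omega> * (X i \<omega>)\<^sup>2 - Y \<omega> * s2 \<omega>) = 0" using iX iS by simp
  then show ?thesis by (simp add: \<xi>_def right_diff_distrib power2_eq_square)
qed

text \<open>An \<open>F\<close>-measurable weight moves inside the conditional expectation, where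
  the almost sure fourth-moment bound applies. \<open>N\<close> supplies integrability and does not
  enter the constant.\<close>

lemma F_square_X4_le:
  assumes i: "i \<in> I" and G: "G \<in> borel_measurable F" and N: "\<And>\<omega>. \<omega> \<in> space M \<Longrightarrow> (G \<omega>)\<^sup>2 \<le> N"
  shows "integrable M (\<lambda>\<omega>. (G \<omega>)\<^sup>2 * X i \<omega> ^ 4)"
    "(LINT \<omega>|M. (G \<omega>)\<^sup>2 * X i \<omega> ^ 4) \<le> C * (LINT \<omega>|M. (G \<omega>)\<^sup>2)"
    "integrable M (\<lambda>\<omega>. (G \<omega>)\<^sup>2)"
proof -
  have [measurable]: "G \<in> borel_measurable F" "G \<in> borel_measurable M" "X i \<in> borel_measurable M"
    using G F_M X i by auto
  have N0: "0 \<le> N" using N not_empty by (metis ex_in_conv order_trans zero_le_power2)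
  show int: "integrable M (\<lambda>\<omega>. (G \<omega>)\<^sup>2 * X i \<omega> ^ 4)"
  proof (rule Bochner_Integration.integrable_bound[where f="\<lambda>\<omega>. N * X i \<omega> ^ 4"])
    show "AE \<omega> in M. norm ((G \<omega>)\<^sup>2 * X i \<omega> ^ 4) \<le> norm (N * X i \<omega> ^ 4)"
      using N N0 by (intro AE_I2) (auto simp: abs_mult intro!: mult_right_mono)
  qed (use int4[OF i] in auto)
  show iG: "integrable M (\<lambda>\<omega>. (G \<omega>)\<^sup>2)"
    by (rule integrable_const_bound[where B=N]) (use N in \<open>auto intro!: AE_I2\<close>)
  have "(LINT \<omega>|M. (G \<omega>)\<^sup>2 * X i \<omega> ^ 4) = (LINT \<omega>|M. (G \<omega>)\<^sup>2 * real_cond_exp M F (\<lambda>\<omega>. X i \<omega> ^ 4) \<omega>)"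
    using int by (intro real_cond_exp_intg(2)[symmetric]) auto
  also have "\<dots> \<le> (LINT \<omega>|M. C * (G \<omega>)\<^sup>2)"
  proof (rule integral_mono_AE)
    show "integrable M (\<lambda>\<omega>. (G \<omega>)\<^sup>2 * real_cond_exp M F (\<lambda>\<omega>. X i \<omega> ^ 4) \<omega>)"
      using int by (intro real_cond_exp_intg(1)) auto
    show "AE \<omega> in M. (G \<omega>)\<^sup>2 * real_cond_exp M F (\<lambda>\<omega>. X i \<omega> ^ 4) \<omega> \<le> C * (G \<omega>)\<^sup>2"
      using m4[OF i] by eventually_elim (simp add: mult.commute[of C] mult_left_mono)
  qed (use iG in auto)
  finally show "(LINT \<omega>|M. (G \<omega>)\<^sup>2 * X i \<omega> ^ 4) \<le> C * (LINT \<omega>|M. (G \<omega>)\<^sup>2)" by simp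
qed

lemma F_square_X2_le:
  assumes i: "i \<in> I" and G: "G \<in> borel_measurable F" and N: "\<And>\<omega>. \<omega> \<in> space M \<Longrightarrow> (G \<omega>)\<^sup>2 \<le> N"
  shows "integrable M (\<lambda>\<omega>. (G \<omega> * X i \<omega>)\<^sup>2)"
    "(LINT \<omega>|M. (G \<omega> * X i \<omega>)\<^sup>2) \<le> C * (LINT \<omega>|M. (G \<omega>)\<^sup>2)"
proof -
  have [measurable]: "G \<in> borel_measurable F" "G \<in> borel_measurable M" "X i \<in> borel_measurable M"
    using G F_M X i by auto
  have N0: "0 \<le> N" using N not_empty by (metis ex_in_conv order_trans zero_le_power2)
  show int: "integrable M (\<lambda>\<omega>. (G \<omega> * X i \<omega>)\<^sup>2)"
  proof (rule Bochner_Integration.integrable_bound[where f="\<lambda>\<omega>. N * (X i \<omega>)\<^sup>2"])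
    show "AE \<omega> in M. norm ((G \<omega> * X i \<omega>)\<^sup>2) \<le> norm (N * (X i \<omega>)\<^sup>2)"
      using N N0 by (intro AE_I2) (auto simp: abs_mult power_mult_distrib intro!: mult_right_mono)
  qed (use integrable_X(2)[OF i] in auto)
  have iG: "integrable M (\<lambda>\<omega>. (G \<omega>)\<^sup>2)" using F_square_X4_le(3)[OF i G N] .
  have int': "integrable M (\<lambda>\<omega>. (G \<omega>)\<^sup>2 * (X i \<omega>)\<^sup>2)" using int by (simp add: power_mult_distrib)
  have "(LINT \<omega>|M. (G \<omega>)\<^sup>2 * (X i \<omega>)\<^sup>2) = (LINT \<omega>|M. (G \<omega>)\<^sup>2 * real_cond_exp M F (\<lambda>\<omega>. (X i \<omega>)\<^sup>2) \<omega>)"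
    using int' by (intro real_cond_exp_intg(2)[symmetric]) auto
  also have "\<dots> \<le> (LINT \<omega>|M. C * (G \<omega>)\<^sup>2)"
  proof (rule integral_mono_AE)
    show "integrable M (\<lambda>\<omega>. (G \<omega>)\<^sup>2 * real_cond_exp M F (\<lambda>\<omega>. (X i \<omega>)\<^sup>2) \<omega>)"
      using int' by (intro real_cond_exp_intg(1)) auto
    show "AE \<omega> in M. (G \<omega>)\<^sup>2 * real_cond_exp M F (\<lambda>\<omega>. (X i \<omega>)\<^sup>2) \<omega> \<le> C * (G \<omega>)\<^sup>2"
      using s2_eq[OF i] s2_bd by eventually_elim (simp add: mult.commute[of C] mult_left_mono)
  qed (use iG in auto)
  finally show "(LINT \<omega>|M. (G \<omega> * X i \<omega>)\<^sup>2) \<le> C * (LINT \<omega>|M. (G \<omega>)\<^sup>2)"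
    by (simp add: power_mult_distrib)
qed

lemma F_\<xi>_squared:
  assumes i: "i \<in> I" and j: "j \<in> I" and G: "G \<in> borel_measurable F"
    and N: "\<And>\<omega>. \<omega> \<in> space M \<Longrightarrow> (G \<omega>)\<^sup>2 \<le> N"
  shows "integrable M (\<lambda>\<omega>. (G \<omega> * \<xi> i j \<omega>)\<^sup>2)"
    "(LINT \<omega>|M. (G \<omega> * \<xi> i j \<omega>)\<^sup>2) \<le> (2 * C + 2 * C\<^sup>2) * (LINT \<omega>|M. (G \<omega>)\<^sup>2)"
proof -
  note [measurable] = F_M[OF G] \<xi>_M[OF i j]
  let ?b = "\<lambda>\<omega>. (G \<omega>)\<^sup>2 * X i \<omega> ^ 4 + (G \<omega>)\<^sup>2 * X j \<omega> ^ 4 + 2 * C\<^sup>2 * (G \<omega>)\<^sup>2"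
  note i4 = F_square_X4_le[OF i G N] and j4 = F_square_X4_le[OF j G N]
  have ib: "integrable M ?b"
    using i4(1,3) j4(1) by (intro Bochner_Integration.integrable_add) auto
  have bd: "AE \<omega> in M. (G \<omega> * \<xi> i j \<omega>)\<^sup>2 \<le> ?b \<omega>"
    using s2_bd
  proof eventually_elim
    case (elim \<omega>)
    let ?x = "X i \<omega>" and ?y = "X j \<omega>" and ?s = "if i = j then s2 \<omega> else 0"
    have "?s\<^sup>2 \<le> C\<^sup>2" using elim by (auto intro: power_mono)
    \<comment> \<open>These squares give
      \<open>(xy - s)\<^sup>2 \<le> 2 x\<^sup>2 y\<^sup>2 + 2 s\<^sup>2\<close> and
      \<open>2 x\<^sup>2 y\<^sup>2 \<le> x\<^sup>4 + y\<^sup>4\<close>; two fourth moments and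
      \<open>2 C\<^sup>2\<close> make up the constant.\<close>
    moreover have "0 \<le> (?x * ?y + ?s)\<^sup>2" "0 \<le> (?x\<^sup>2 - ?y\<^sup>2)\<^sup>2" by simp_all
    moreover have "?x ^ 4 = (?x\<^sup>2)\<^sup>2" "?y ^ 4 = (?y\<^sup>2)\<^sup>2" by (simp_all add: power_mult[symmetric])
    ultimately have "(?x * ?y - ?s)\<^sup>2 \<le> ?x ^ 4 + ?y ^ 4 + 2 * C\<^sup>2"
      by (simp only: power2_diff power2_sum power_mult_distrib)
    then have "(G \<omega>)\<^sup>2 * (?x * ?y - ?s)\<^sup>2 \<le> (G \<omega>)\<^sup>2 * (?x ^ 4 + ?y ^ 4 + 2 * C\<^sup>2)"
      by (intro mult_left_mono) auto
    also have "\<dots> = ?b \<omega>" by (simp add: algebra_simps)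
    finally show ?case unfolding \<xi>_def power_mult_distrib[of "G \<omega>"] .
  qed
  show int: "integrable M (\<lambda>\<omega>. (G \<omega> * \<xi> i j \<omega>)\<^sup>2)"
    by (rule Bochner_Integration.integrable_bound[OF ib])
      (use bd in \<open>auto elim!: eventually_mono intro: order_trans[OF _ abs_ge_self]\<close>)
  have "(LINT \<omega>|M. (G \<omega> * \<xi> i j \<omega>)\<^sup>2) \<le> (LINT \<omega>|M. ?b \<omega>)"
    using int ib bd by (rule integral_mono_AE)
  also have "\<dots> = (LINT \<omega>|M. (G \<omega>)\<^sup>2 * X i \<omega> ^ 4) + (LINT \<omega>|M. (G \<omega>)\<^sup>2 * X j \<omega> ^ 4) + 2 * C\<^sup>2 * (LINT \<omega>|M. (G \<omega>)\<^sup>2)"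
    using i4(1,3) j4(1) by simp
  also have "\<dots> \<le> (2 * C + 2 * C\<^sup>2) * (LINT \<omega>|M. (G \<omega>)\<^sup>2)"
    using i4(2) j4(2) by (simp add: algebra_simps)
  finally show "(LINT \<omega>|M. (G \<omega> * \<xi> i j \<omega>)\<^sup>2) \<le> (2 * C + 2 * C\<^sup>2) * (LINT \<omega>|M. (G \<omega>)\<^sup>2)" .
qed

text \<open>The index \<open>i\<close> occurs once among the four, so \<open>X i\<close> splits off
  linearly from a factor that depends only on \<open>F\<close> and the other variables; its
  conditional mean is zero.\<close>

lemma \<xi>_orth_offdiag:
  assumes I: "i \<in> I" "j \<in> I" "k \<in> I" "l \<in> I" and G: "G \<in> borel_measurable F" "G' \<in> borel_measurable F"
    and i: "i \<noteq> j" "i \<noteq> k" "i \<noteq> l"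
    and N: "\<And>\<omega>. \<omega> \<in> space M \<Longrightarrow> (G \<omega>)\<^sup>2 \<le> N" "\<And>\<omega>. \<omega> \<in> space M \<Longrightarrow> (G' \<omega>)\<^sup>2 \<le> N"
  shows "(LINT \<omega>|M. (G \<omega> * \<xi> i j \<omega>) * (G' \<omega> * \<xi> k l \<omega>)) = 0"
proof -
  let ?Y = "\<lambda>\<omega>. G \<omega> * X j \<omega> * (G' \<omega> * \<xi> k l \<omega>)"
  have eq: "(G \<omega> * \<xi> i j \<omega>) * (G' \<omega> * \<xi> k l \<omega>) = ?Y \<omega> * X i \<omega>" for \<omega>
    using i unfolding \<xi>_def[of i j] by simp
  have "?Y \<in> borel_measurable (others_alg i)"
    using I i G by (intro borel_measurable_times F_others X_others \<xi>_others) auto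
  moreover have "integrable M (\<lambda>\<omega>. (G \<omega> * \<xi> i j \<omega>) * (G' \<omega> * \<xi> k l \<omega>))"
    using I G N by (intro integrable_mult_squares F_\<xi>_squared borel_measurable_times F_M \<xi>_M) auto
  ultimately show ?thesis unfolding eq by (intro integral_mult_X[OF I(1)])
qed

text \<open>No index occurs just once here; instead the centring by \<open>s2\<close> gives
  \<open>\<xi> i i\<close> conditional mean zero.\<close>

lemma \<xi>_orth_diag:
  assumes I: "i \<in> I" "k \<in> I" and G: "G \<in> borel_measurable F" "G' \<in> borel_measurable F"
    and i: "i \<noteq> k"
    and N: "\<And>\<omega>. \<omega> \<in> space M \<Longrightarrow> (G \<omega>)\<^sup>2 \<le> N" "\<And>\<omega>. \<omega> \<in> space M \<Longrightarrow> (G' \<omega>)\<^sup>2 \<le> N"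
  shows "(LINT \<omega>|M. (G \<omega> * \<xi> i i \<omega>) * (G' \<omega> * \<xi> k k \<omega>)) = 0"
proof -
  let ?Y = "\<lambda>\<omega>. (G \<omega> * G' \<omega>) * \<xi> k k \<omega>"
  have eq: "(G \<omega> * \<xi> i i \<omega>) * (G' \<omega> * \<xi> k k \<omega>) = ?Y \<omega> * \<xi> i i \<omega>" for \<omega>
    by simp
  have "?Y \<in> borel_measurable (others_alg i)"
    using I i G by (intro borel_measurable_times F_others \<xi>_others) auto
  moreover have "integrable M (\<lambda>\<omega>. (?Y \<omega>)\<^sup>2)"
  proof (rule F_\<xi>_squared(1)[where N="N * N"])
    fix \<omega> assume \<omega>: "\<omega> \<in> space M"
    have "0 \<le> N" using N(1)[OF \<omega>] by (rule order_trans[OF zero_le_power2])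
    then show "(G \<omega> * G' \<omega>)\<^sup>2 \<le> N * N"
      unfolding power_mult_distrib using N[OF \<omega>] by (intro mult_mono) simp_all
  qed (use I G in auto)
  ultimately show ?thesis unfolding eq by (intro integral_mult_\<xi>_diag[OF I(1)])
qed

text \<open>Chebyshev's inequality. The constant is twice that of \<open>F_\<xi>_squared\<close>,
  because the terms at \<open>(i, j)\<close> and \<open>(j, i)\<close> are correlated.\<close>

lemma quadratic_form_bound:
  assumes G: "\<And>i j. i \<in> I \<Longrightarrow> j \<in> I \<Longrightarrow> G i j \<in> borel_measurable F"
    and N: "\<And>\<omega>. \<omega> \<in> space M \<Longrightarrow> (\<Sum>i\<in>I. \<Sum>j\<in>I. (G i j \<omega>)\<^sup>2) \<le> N" and d: "0 < d"
  shows "measure M {\<omega>\<in>space M. \<bar>\<Sum>i\<in>I. \<Sum>j\<in>I. G i j \<omega> * \<xi> i j \<omega>\<bar> > d} \<le> (4 * C + 4 * C\<^sup>2) * N / d\<^sup>2"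
proof -
  let ?A = "I \<times> I"
  let ?G = "\<lambda>a. G (fst a) (snd a)"
  let ?Z = "\<lambda>a \<omega>. ?G a \<omega> * \<xi> (fst a) (snd a) \<omega>"
  let ?\<tau> = "\<lambda>a. (snd a, fst a) :: 'b \<times> 'b"
  have fin: "finite ?A" using finI by simp
  have sumA: "(\<Sum>a\<in>?A. (?G a \<omega>)\<^sup>2) \<le> N" if "\<omega> \<in> space M" for \<omega>
    using N[OF that] by (simp add: sum.cartesian_product case_prod_beta)
  have GN: "(?G a \<omega>)\<^sup>2 \<le> N" if "\<omega> \<in> space M" "a \<in> ?A" for a \<omega>
    using member_le_sum[of a ?A "\<lambda>a. (?G a \<omega>)\<^sup>2"] sumA[OF that(1)] that(2) fin by fastforce
  have GF: "?G a \<in> borel_measurable F" if "a \<in> ?A" for a using G that by auto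
  have Zm: "?Z a \<in> borel_measurable M" if "a \<in> ?A" for a
    using that by (intro borel_measurable_times F_M[OF GF] \<xi>_M) auto
  have sq: "integrable M (\<lambda>\<omega>. (?Z a \<omega>)\<^sup>2)"
    "(LINT \<omega>|M. (?Z a \<omega>)\<^sup>2) \<le> (2 * C + 2 * C\<^sup>2) * (LINT \<omega>|M. (?G a \<omega>)\<^sup>2)" if a: "a \<in> ?A" for a
    using F_\<xi>_squared[of "fst a" "snd a", OF _ _ GF[OF a] GN[OF _ a]] a by auto
  have orth: "(LINT \<omega>|M. ?Z a \<omega> * ?Z b \<omega>) = 0"
    if a: "a \<in> ?A" and b: "b \<in> ?A" and ab: "b \<noteq> a" "b \<noteq> ?\<tau> a" for a b
  proof -
    obtain i j k l where ij: "a = (i, j)" and kl: "b = (k, l)" by (cases a, cases b) auto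
    have I: "i \<in> I" "j \<in> I" "k \<in> I" "l \<in> I" using a b ij kl by auto
    note f = GF[OF a] GF[OF b] and n = GN[OF _ a] GN[OF _ b]
    have "(LINT \<omega>|M. (?G a \<omega> * \<xi> i j \<omega>) * (?G b \<omega> * \<xi> k l \<omega>)) = 0"
    proof -
      \<comment> \<open>For distinct unordered pairs, either some index occurs exactly once among
        the four, or both pairs are diagonal.\<close>
      consider "i \<noteq> j" "i \<noteq> k" "i \<noteq> l" | "j \<noteq> i" "j \<noteq> k" "j \<noteq> l"
        | "k \<noteq> l" "k \<noteq> i" "k \<noteq> j" | "l \<noteq> k" "l \<noteq> i" "l \<noteq> j" | "i = j" "k = l" "i \<noteq> k"
        using ab ij kl by auto
      then show ?thesis
      proof cases
        case 1 then show ?thesis using I f n by (intro \<xi>_orth_offdiag) auto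
      next
        case 2 then show ?thesis using I f n by (subst \<xi>_commute) (intro \<xi>_orth_offdiag; auto)
      next
        case 3 then show ?thesis using I f n by (subst mult.commute) (intro \<xi>_orth_offdiag; auto)
      next
        case 4 then show ?thesis using I f n
          by (subst mult.commute, subst \<xi>_commute[of k]) (intro \<xi>_orth_offdiag; auto)
      next
        case 5 then show ?thesis using I f n by (simp only:) (intro \<xi>_orth_diag; auto)
      qed
    qed
    then show ?thesis unfolding ij kl by simp
  qed
  have eq: "(\<Sum>i\<in>I. \<Sum>j\<in>I. G i j \<omega> * \<xi> i j \<omega>) = (\<Sum>a\<in>?A. ?Z a \<omega>)" for \<omega>
    by (simp add: sum.cartesian_product case_prod_beta)
  have "integrable M (\<lambda>\<omega>. (\<Sum>a\<in>?A. ?Z a \<omega>)\<^sup>2)"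
    and le: "(LINT \<omega>|M. (\<Sum>a\<in>?A. ?Z a \<omega>)\<^sup>2) \<le> 2 * (\<Sum>a\<in>?A. LINT \<omega>|M. (?Z a \<omega>)\<^sup>2)"
    by (rule integral_sum_squared_le[where \<tau>="?\<tau>", OF fin _ _ Zm sq(1) orth]; auto)+
  then have "measure M {\<omega>\<in>space M. \<bar>\<Sum>a\<in>?A. ?Z a \<omega>\<bar> > d} \<le> (LINT \<omega>|M. (\<Sum>a\<in>?A. ?Z a \<omega>)\<^sup>2) / d\<^sup>2"
    using d by (intro prob_abs_gt_le borel_measurable_sum Zm) auto
  also have "\<dots> \<le> ((4 * C + 4 * C\<^sup>2) * N) / d\<^sup>2"
  proof (rule divide_right_mono)
    have iG: "integrable M (\<lambda>\<omega>. (?G a \<omega>)\<^sup>2)" if "a \<in> ?A" for a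
      using F_square_X4_le(3)[of "fst a" "?G a" N] GF[OF that] GN[OF _ that] that by auto
    have "(\<Sum>a\<in>?A. LINT \<omega>|M. (?Z a \<omega>)\<^sup>2) \<le> (\<Sum>a\<in>?A. (2 * C + 2 * C\<^sup>2) * (LINT \<omega>|M. (?G a \<omega>)\<^sup>2))"
      by (intro sum_mono sq)
    also have "\<dots> = (2 * C + 2 * C\<^sup>2) * (LINT \<omega>|M. (\<Sum>a\<in>?A. (?G a \<omega>)\<^sup>2))"
      using iG by (subst Bochner_Integration.integral_sum) (auto simp: sum_distrib_left)
    also have "\<dots> \<le> (2 * C + 2 * C\<^sup>2) * N"
    proof (rule mult_left_mono)
      have "(LINT \<omega>|M. (\<Sum>a\<in>?A. (?G a \<omega>)\<^sup>2)) \<le> (LINT \<omega>|M. N)"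
        using iG sumA by (intro integral_mono Bochner_Integration.integrable_sum) auto
      then show "(LINT \<omega>|M. (\<Sum>a\<in>?A. (?G a \<omega>)\<^sup>2)) \<le> N" by (simp add: prob_space)
    qed (use C_nonneg in auto)
    finally show "(LINT \<omega>|M. (\<Sum>a\<in>?A. ?Z a \<omega>)\<^sup>2) \<le> (4 * C + 4 * C\<^sup>2) * N"
      using le by (simp add: algebra_simps)
  qed simp
  finally show ?thesis unfolding eq .
qed

lemma linear_form_bound:
  assumes G: "\<And>i. i \<in> I \<Longrightarrow> G i \<in> borel_measurable F"
    and N: "\<And>\<omega>. \<omega> \<in> space M \<Longrightarrow> (\<Sum>i\<in>I. (G i \<omega>)\<^sup>2) \<le> N" and d: "0 < d"
  shows "measure M {\<omega>\<in>space M. \<bar>\<Sum>i\<in>I. G i \<omega> * X i \<omega>\<bar> > d} \<le> 2 * C * N / d\<^sup>2"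
proof -
  let ?Z = "\<lambda>a \<omega>. G a \<omega> * X a \<omega>"
  have GN: "(G a \<omega>)\<^sup>2 \<le> N" if "\<omega> \<in> space M" "a \<in> I" for a \<omega>
    using member_le_sum[of a I "\<lambda>a. (G a \<omega>)\<^sup>2"] N[OF that(1)] that(2) finI by fastforce
  have Zm: "?Z a \<in> borel_measurable M" if "a \<in> I" for a
    using that by (intro borel_measurable_times F_M G X) auto
  note sq = F_square_X2_le[OF _ G GN]
  have orth: "(LINT \<omega>|M. ?Z a \<omega> * ?Z b \<omega>) = 0" if a: "a \<in> I" and b: "b \<in> I" and ab: "b \<noteq> a" for a b
  proof -
    have "integrable M (\<lambda>\<omega>. ?Z a \<omega> * ?Z b \<omega>)"
      using a b by (intro integrable_mult_squares sq Zm) auto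
    moreover have "(\<lambda>\<omega>. (G a \<omega> * G b \<omega>) * X b \<omega>) \<in> borel_measurable (others_alg a)"
      using a b ab G by (intro borel_measurable_times F_others X_others) auto
    ultimately have "(LINT \<omega>|M. ((G a \<omega> * G b \<omega>) * X b \<omega>) * X a \<omega>) = 0"
      by (intro integral_mult_X[OF a]) (auto simp: mult_ac)
    then show ?thesis by (simp add: mult_ac)
  qed
  \<comment> \<open>The terms are pairwise uncorrelated, so \<open>\<tau>\<close> is the identity
    and the factor 2 of the general bound is mere slack.\<close>
  have "integrable M (\<lambda>\<omega>. (\<Sum>a\<in>I. ?Z a \<omega>)\<^sup>2)"
    and le: "(LINT \<omega>|M. (\<Sum>a\<in>I. ?Z a \<omega>)\<^sup>2) \<le> 2 * (\<Sum>a\<in>I. LINT \<omega>|M. (?Z a \<omega>)\<^sup>2)"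
    by (rule integral_sum_squared_le[where \<tau>="\<lambda>a. a", OF finI _ _ Zm sq(1) orth]; auto)+
  then have "measure M {\<omega>\<in>space M. \<bar>\<Sum>a\<in>I. ?Z a \<omega>\<bar> > d} \<le> (LINT \<omega>|M. (\<Sum>a\<in>I. ?Z a \<omega>)\<^sup>2) / d\<^sup>2"
    using d by (intro prob_abs_gt_le borel_measurable_sum Zm) auto
  also have "\<dots> \<le> (2 * C * N) / d\<^sup>2"
  proof (rule divide_right_mono)
    have iG: "integrable M (\<lambda>\<omega>. (G a \<omega>)\<^sup>2)" if "a \<in> I" for a
      using F_square_X4_le(3)[OF that G[OF that] GN[OF _ that]] .
    have "(\<Sum>a\<in>I. LINT \<omega>|M. (?Z a \<omega>)\<^sup>2) \<le> (\<Sum>a\<in>I. C * (LINT \<omega>|M. (G a \<omega>)\<^sup>2))"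
      by (intro sum_mono sq) auto
    also have "\<dots> = C * (LINT \<omega>|M. (\<Sum>a\<in>I. (G a \<omega>)\<^sup>2))"
      using iG by (subst Bochner_Integration.integral_sum) (auto simp: sum_distrib_left)
    also have "\<dots> \<le> C * N"
    proof (rule mult_left_mono)
      have "(LINT \<omega>|M. (\<Sum>a\<in>I. (G a \<omega>)\<^sup>2)) \<le> (LINT \<omega>|M. N)"
        using iG N by (intro integral_mono Bochner_Integration.integrable_sum) auto
      then show "(LINT \<omega>|M. (\<Sum>a\<in>I. (G a \<omega>)\<^sup>2)) \<le> N" by (simp add: prob_space)
    qed (use C_nonneg in auto)
    finally show "(LINT \<omega>|M. (\<Sum>a\<in>I. ?Z a \<omega>)\<^sup>2) \<le> 2 * C * N"
      using le by (simp add: algebra_simps)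
  qed simp
  finally show ?thesis .
qed

end

section \<open>Forms in shifted subfamilies\<close>

lemma sum_reindex_support:
  fixes h :: "'i \<Rightarrow> real"
  assumes "finite I" "inj_on a P" "a ` P \<subseteq> I" and 0: "\<And>i. i \<in> I \<Longrightarrow> i \<notin> a ` P \<Longrightarrow> h i = 0"
  shows "(\<Sum>i\<in>I. h i) = (\<Sum>p\<in>P. h (a p))"
proof -
  have "(\<Sum>i\<in>I. h i) = (\<Sum>i\<in>a ` P. h i)"
    using assms(1,3) 0 by (intro sum.mono_neutral_right) auto
  then show ?thesis using assms(2) by (simp add: sum.reindex)
qed

context cond_iid_moments
begin

text \<open>The lagged errors sit at the indices \<open>i\<close> and the current ones at
  \<open>Suc i\<close> of one family; a form in them becomes a form over the whole family when its
  coefficients are extended by zero.\<close>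

lemma quadratic_form_reindex_bound:
  assumes a: "inj_on a P" "a ` P \<subseteq> I" and b: "inj_on b Q" "b ` Q \<subseteq> I"
    and G: "\<And>p q. p \<in> P \<Longrightarrow> q \<in> Q \<Longrightarrow> G p q \<in> borel_measurable F"
    and N: "\<And>\<omega>. \<omega> \<in> space M \<Longrightarrow> (\<Sum>p\<in>P. \<Sum>q\<in>Q. (G p q \<omega>)\<^sup>2) \<le> N" and d: "0 < d"
  shows "measure M {\<omega>\<in>space M. \<bar>\<Sum>p\<in>P. \<Sum>q\<in>Q. G p q \<omega> * \<xi> (a p) (b q) \<omega>\<bar> > d} \<le> (4 * C + 4 * C\<^sup>2) * N / d\<^sup>2"
proof -
  define G' where "G' = (\<lambda>i j \<omega>. if i \<in> a ` P \<and> j \<in> b ` Q then G (inv_into P a i) (inv_into Q b j) \<omega> else 0)"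
  have G': "G' (a p) (b q) \<omega> = G p q \<omega>" if "p \<in> P" "q \<in> Q" for p q \<omega>
    using that a b unfolding G'_def by simp
  have G'F: "G' i j \<in> borel_measurable F" for i j
  proof (cases "i \<in> a ` P \<and> j \<in> b ` Q")
    case True
    then show ?thesis unfolding G'_def using G by (auto simp: inv_into_into)
  next
    case False
    then have "G' i j = (\<lambda>_. 0)" unfolding G'_def by auto
    then show ?thesis by simp
  qed
  \<comment> \<open>One statement serves twice: \<open>f\<close> the square and \<open>h\<close>
    constantly 1 for the coefficient bound, \<open>f\<close> the identity for the form
    itself.\<close>
  have sum: "(\<Sum>i\<in>I. \<Sum>j\<in>I. f (G' i j \<omega>) * h i j) = (\<Sum>p\<in>P. \<Sum>q\<in>Q. f (G p q \<omega>) * h (a p) (b q))"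
    if "f 0 = 0" for f :: "real \<Rightarrow> real" and h :: "'b \<Rightarrow> 'b \<Rightarrow> real" and \<omega>
  proof -
    have "(\<Sum>i\<in>I. \<Sum>j\<in>I. f (G' i j \<omega>) * h i j) = (\<Sum>p\<in>P. \<Sum>j\<in>I. f (G' (a p) j \<omega>) * h (a p) j)"
      by (rule sum_reindex_support[OF finI a]) (simp add: G'_def that)
    also have "\<dots> = (\<Sum>p\<in>P. \<Sum>q\<in>Q. f (G' (a p) (b q) \<omega>) * h (a p) (b q))"
      by (intro sum.cong refl sum_reindex_support[OF finI b]) (simp add: G'_def that)
    also have "\<dots> = (\<Sum>p\<in>P. \<Sum>q\<in>Q. f (G p q \<omega>) * h (a p) (b q))"
      by (intro sum.cong refl) (simp add: G')
    finally show ?thesis .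
  qed
  show ?thesis
    using quadratic_form_bound[of G' N d] G'F N d sum[of "\<lambda>x. x\<^sup>2" _ "\<lambda>_ _. 1"]
      sum[of "\<lambda>x. x" _ "\<lambda>i j. \<xi> i j _"] by simp
qed

lemma linear_form_reindex_bound:
  assumes a: "inj_on a P" "a ` P \<subseteq> I"
    and G: "\<And>p. p \<in> P \<Longrightarrow> G p \<in> borel_measurable F"
    and N: "\<And>\<omega>. \<omega> \<in> space M \<Longrightarrow> (\<Sum>p\<in>P. (G p \<omega>)\<^sup>2) \<le> N" and d: "0 < d"
  shows "measure M {\<omega>\<in>space M. \<bar>\<Sum>p\<in>P. G p \<omega> * X (a p) \<omega>\<bar> > d} \<le> 2 * C * N / d\<^sup>2"
proof -
  define G' where "G' = (\<lambda>i \<omega>. if i \<in> a ` P then G (inv_into P a i) \<omega> else 0)"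
  have G': "G' (a p) \<omega> = G p \<omega>" if "p \<in> P" for p \<omega>
    using that a unfolding G'_def by simp
  have G'F: "G' i \<in> borel_measurable F" for i
  proof (cases "i \<in> a ` P")
    case True
    then show ?thesis unfolding G'_def using G by (auto simp: inv_into_into)
  next
    case False
    then have "G' i = (\<lambda>_. 0)" unfolding G'_def by auto
    then show ?thesis by simp
  qed
  have sum: "(\<Sum>i\<in>I. f (G' i \<omega>) * h i) = (\<Sum>p\<in>P. f (G p \<omega>) * h (a p))"
    if "f 0 = 0" for f :: "real \<Rightarrow> real" and h :: "'b \<Rightarrow> real" and \<omega>
  proof -
    have "(\<Sum>i\<in>I. f (G' i \<omega>) * h i) = (\<Sum>p\<in>P. f (G' (a p) \<omega>) * h (a p))"
      by (rule sum_reindex_support[OF finI a]) (simp add: G'_def that)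
    then show ?thesis by (simp add: G')
  qed
  show ?thesis
    using linear_form_bound[of G' N d] G'F N d sum[of "\<lambda>x. x\<^sup>2" _ "\<lambda>_. 1"]
      sum[of "\<lambda>x. x" _ "\<lambda>i. X i _"] by simp
qed

end

section \<open>Measurability of the residual maker\<close>

lemma subalgebra_gen_sigma:
  assumes "\<And>i j. (\<lambda>\<omega>. A \<omega> i j) \<in> borel_measurable M"
  shows "subalgebra M (gen_sigma M m n A)"
proof -
  let ?f = "\<lambda>\<omega>. \<lambda>p\<in>{..<m}\<times>{..<n}. A \<omega> (fst p) (snd p)"
  have f: "?f \<in> measurable M (Pi\<^sub>M ({..<m}\<times>{..<n}) (\<lambda>_. borel))"
    using assms by (intro measurable_restrict) simp
  have sp: "?f \<in> space M \<rightarrow> space (Pi\<^sub>M ({..<m}\<times>{..<n}) (\<lambda>_. borel))"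
    by (intro Pi_I measurable_space[OF f])
  then show ?thesis
    unfolding subalgebra_def gen_sigma_def sets_vimage_algebra2[OF sp]
    using measurable_sets[OF f] by auto
qed

lemma gen_sigma_entry:
  assumes "i < m" "j < n"
  shows "(\<lambda>\<omega>. A \<omega> i j) \<in> borel_measurable (gen_sigma M m n A)"
proof -
  let ?f = "\<lambda>\<omega>. \<lambda>p\<in>{..<m}\<times>{..<n}. A \<omega> (fst p) (snd p)"
  have "?f \<in> measurable (gen_sigma M m n A) (Pi\<^sub>M ({..<m}\<times>{..<n}) (\<lambda>_. borel))"
    unfolding gen_sigma_def by (rule measurable_vimage_algebra1) (auto simp: space_PiM)
  then have "(\<lambda>\<omega>. ?f \<omega> (i, j)) \<in> borel_measurable (gen_sigma M m n A)"
    by (rule measurable_compose[OF _ measurable_component_singleton]) (use assms in simp)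
  then show ?thesis using assms by simp
qed

context
  fixes N :: "'a measure" and Xt :: "'a \<Rightarrow> nat \<Rightarrow> nat \<Rightarrow> real" and m n :: nat
  assumes entries: "\<And>i j. i < m \<Longrightarrow> j < n \<Longrightarrow> (\<lambda>\<omega>. Xt \<omega> i j) \<in> borel_measurable N"
    and rank: "\<And>\<omega>. \<omega> \<in> space N \<Longrightarrow> full_col_rank m n (Xt \<omega>)"
begin

lemma measurable_minv_gram:
  assumes "i < n" "j < n"
  shows "(\<lambda>\<omega>. minv n (mmul m (mtr (Xt \<omega>)) (Xt \<omega>)) i j) \<in> borel_measurable N"
proof -
  have "(\<lambda>\<omega>. adj_inv n (mmul m (mtr (Xt \<omega>)) (Xt \<omega>)) i j) \<in> borel_measurable N"
    unfolding mmul_def mtr_def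
    by (intro measurable_adj_inv assms borel_measurable_sum borel_measurable_times entries) auto
  then show ?thesis
    by (subst measurable_cong[OF minv_eq_adj_inv[OF adj_inv_gram[OF rank] assms]])
qed

lemma measurable_resid_maker:
  assumes "i < m" "j < m"
  shows "(\<lambda>\<omega>. resid_maker m n (Xt \<omega>) i j) \<in> borel_measurable N"
proof -
  have eq: "mmul n (mmul n X Y) (mtr X) i j = (\<Sum>b<n. (\<Sum>a<n. X i a * Y a b) * X j b)" for X Y
    by (simp add: mmul_def mtr_def)
  show ?thesis
    unfolding resid_maker_def eq
    by (intro borel_measurable_diff borel_measurable_const borel_measurable_sum borel_measurable_times
      entries measurable_minv_gram assms) auto
qed

lemma measurable_dual_vector:
  assumes "i < m"
  shows "(\<lambda>\<omega>. mv n (Xt \<omega>) (mv n (minv n (mmul m (mtr (Xt \<omega>)) (Xt \<omega>))) a) i) \<in> borel_measurable N"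
  unfolding mv_def
  by (intro borel_measurable_sum borel_measurable_times borel_measurable_const
    entries measurable_minv_gram assms) auto

lemma measurable_qform_minv_gram:
  assumes "c \<noteq> 0"
  shows "(\<lambda>\<omega>. qform n (minv n (\<lambda>i j. mmul m (mtr (Xt \<omega>)) (Xt \<omega>) i j / c)) a) \<in> borel_measurable N"
proof -
  have "(\<lambda>\<omega>. c * qform n (minv n (mmul m (mtr (Xt \<omega>)) (Xt \<omega>))) a) \<in> borel_measurable N"
    unfolding qform_def
    by (intro borel_measurable_sum borel_measurable_times borel_measurable_const measurable_minv_gram) auto
  then show ?thesis
    by (subst measurable_cong[OF qform_minv_scale[OF adj_inv_gram[OF rank] assms]])
qed

end

section \<open>The variance ratio\<close>

text \<open>Here \<open>p\<close>, \<open>w\<close>, \<open>q\<close> stand for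
  \<open>U / m\<close>, \<open>W / m\<close>, \<open>D / m\<close>, \<open>k\<close> for
  \<open>m * a0\<close> and \<open>l\<close> for the subdiagonal sum over \<open>m\<close>. At
  \<open>p = w = s\<close>, \<open>q = s * l\<close>, \<open>h = 0\<close>, \<open>g = 1\<close> the
  two expressions agree. \<open>Q\<close> bounds \<open>q\<close> and \<open>s * l\<close>; the
  three summands of \<open>Kc\<close> come from the error in \<open>p\<close>, from the terms with
  \<open>h\<close>, and from the term with \<open>q\<^sup>2\<close>.\<close>

lemma limit_ratio_bound:
  fixes c C B :: real
  defines "Q \<equiv> C / c + 1"
  defines "Kc \<equiv> 1 / c + 4 * (C + 1 + 3 * Q) / c + 4 * B * (2 * Q * (1 + C * B) + Q\<^sup>2 * (B + 3)) / c"
  assumes c: "0 < c" "c < s" "s < C" and B: "0 \<le> k" "k \<le> B"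
    and \<delta>: "0 < \<delta>" "\<delta> \<le> 1 / 2" "\<delta> \<le> c / 2"
    and p: "\<bar>p - s\<bar> \<le> \<delta>" and w: "\<bar>w - s\<bar> \<le> \<delta>" and q: "\<bar>q - s * l\<bar> \<le> \<delta>" and l: "\<bar>l\<bar> \<le> 1 / c"
    and h: "\<bar>h\<bar> \<le> \<delta>" and g: "\<bar>g - 1\<bar> \<le> \<delta>"
  shows "\<bar>(p + (w * h\<^sup>2 - 2 * q * g * h - k * q\<^sup>2) / (k * w + g\<^sup>2)) / s - (1 - s * (k / (1 + s * k)) * l\<^sup>2)\<bar> \<le> Kc * \<delta>"
proof -
  have C0: "0 < C" using c by simp
  have Q0: "1 \<le> Q" unfolding Q_def using c C0 by simp
  have s0: "0 < s" using c by simp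
  have sl: "\<bar>s * l\<bar> \<le> C / c"
  proof -
    have "\<bar>s\<bar> * \<bar>l\<bar> \<le> C * (1 / c)" using c l C0 by (intro mult_mono) auto
    then show ?thesis by (simp add: abs_mult)
  qed
  have qQ: "\<bar>q\<bar> \<le> Q" using q sl \<delta> unfolding Q_def by linarith
  have slQ: "\<bar>s * l\<bar> \<le> Q" using sl unfolding Q_def by linarith
  have w0: "0 < w" "w \<le> C + 1" using w c \<delta> by linarith+
  have g1: "1 / 2 \<le> g" "g \<le> 3 / 2" using g \<delta> by linarith+
  have gg: "1 / 4 \<le> g\<^sup>2" using power_mono[of "1/2" g 2] g1 by (simp add: power2_eq_square)
  define De where "De = k * w + g\<^sup>2"
  define E where "E = 1 + s * k"
  \<comment> \<open>\<open>\<delta> \<le> 1 / 2\<close> gives \<open>g \<ge> 1 / 2\<close>, so the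
    denominator stays above \<open>1 / 4\<close> even if \<open>k = 0\<close>; this is the source of
    the factors 4 in \<open>Kc\<close>.\<close>
  have De: "1 / 4 \<le> De" unfolding De_def using gg B w0 by (simp add: add_increasing)
  have E1: "1 \<le> E" unfolding E_def using B s0 by simp
  have EB: "E \<le> 1 + C * B" unfolding E_def using B c C0 by (simp add: mult_mono)
  have eq: "(p + (w * h\<^sup>2 - 2 * q * g * h - k * q\<^sup>2) / De) / s - (1 - s * (k / E) * l\<^sup>2)
    = (p - s) / s + (w * h\<^sup>2 - 2 * q * g * h) / (s * De) - k * (q\<^sup>2 * E - (s * l)\<^sup>2 * De) / (s * De * E)"
    using s0 De E1 by (simp add: field_simps power2_eq_square)
  have hh: "h\<^sup>2 \<le> \<delta>"
  proof -
    have "h\<^sup>2 \<le> \<delta> * \<delta>" using h \<delta> by (simp add: power2_eq_square abs_mult_self_eq[symmetric, of h] mult_mono del: abs_mult_self_eq)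
    also have "\<dots> \<le> \<delta> * 1" using \<delta> by (intro mult_left_mono) auto
    finally show ?thesis by simp
  qed
  have t1: "\<bar>(p - s) / s\<bar> \<le> 1 / c * \<delta>"
  proof -
    have "\<bar>p - s\<bar> / s \<le> \<delta> / c" using p c \<delta> by (intro frac_le) auto
    then show ?thesis using s0 by (simp add: abs_divide)
  qed
  have t2: "\<bar>(w * h\<^sup>2 - 2 * q * g * h) / (s * De)\<bar> \<le> 4 * (C + 1 + 3 * Q) / c * \<delta>"
  proof -
    have "\<bar>w * h\<^sup>2\<bar> \<le> (C + 1) * \<delta>" using w0 hh by (simp add: abs_mult mult_mono)
    moreover have "\<bar>2 * q * g * h\<bar> \<le> 3 * Q * \<delta>"
    proof -
      have qg: "\<bar>q\<bar> * \<bar>g\<bar> \<le> Q * (3 / 2)" using qQ g1 Q0 by (intro mult_mono) auto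
      have "(\<bar>q\<bar> * \<bar>g\<bar>) * \<bar>h\<bar> \<le> (Q * (3 / 2)) * \<delta>"
        by (rule mult_mono[OF qg h]) (use Q0 in auto)
      then show ?thesis by (simp add: abs_mult)
    qed
    ultimately have "\<bar>w * h\<^sup>2 - 2 * q * g * h\<bar> \<le> (C + 1 + 3 * Q) * \<delta>"
      by (simp add: algebra_simps abs_le_iff)
    moreover have "c * (1 / 4) \<le> s * De" using c De by (intro mult_mono) auto
    ultimately have "\<bar>w * h\<^sup>2 - 2 * q * g * h\<bar> / (s * De) \<le> ((C + 1 + 3 * Q) * \<delta>) / (c * (1 / 4))"
      using c C0 Q0 \<delta> by (intro frac_le) auto
    then show ?thesis using s0 De by (simp add: abs_mult algebra_simps)
  qed
  have t3: "\<bar>k * (q\<^sup>2 * E - (s * l)\<^sup>2 * De) / (s * De * E)\<bar>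
      \<le> 4 * B * (2 * Q * (1 + C * B) + Q\<^sup>2 * (B + 3)) / c * \<delta>"
  proof -
    have "\<bar>q\<^sup>2 - (s * l)\<^sup>2\<bar> = \<bar>q - s * l\<bar> * \<bar>q + s * l\<bar>"
      by (simp add: abs_mult[symmetric] power2_eq_square algebra_simps)
    also have "\<dots> \<le> \<delta> * (2 * Q)" using q qQ slQ \<delta> by (intro mult_mono) auto
    finally have "\<bar>q\<^sup>2 - (s * l)\<^sup>2\<bar> * E \<le> (\<delta> * (2 * Q)) * (1 + C * B)"
      using EB E1 \<delta> Q0 by (intro mult_mono) auto
    then have 1: "\<bar>(q\<^sup>2 - (s * l)\<^sup>2) * E\<bar> \<le> (\<delta> * (2 * Q)) * (1 + C * B)"
      using E1 by (simp add: abs_mult)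
    have "\<bar>k * (s - w)\<bar> \<le> B * \<delta>" using B w \<delta> by (simp add: abs_mult abs_minus_commute mult_mono)
    moreover have "\<bar>1 - g\<^sup>2\<bar> \<le> 3 * \<delta>"
    proof -
      have "\<bar>1 - g\<^sup>2\<bar> = \<bar>g - 1\<bar> * \<bar>g + 1\<bar>"
        unfolding abs_mult[symmetric] by (subst abs_minus_commute) (simp add: power2_eq_square algebra_simps)
      also have "\<dots> \<le> \<delta> * 3" using g g1 \<delta> by (intro mult_mono) auto
      finally show ?thesis by simp
    qed
    ultimately have "\<bar>E - De\<bar> \<le> (B + 3) * \<delta>"
      unfolding E_def De_def by (simp add: algebra_simps abs_le_iff)
    moreover have "(s * l)\<^sup>2 \<le> Q\<^sup>2" using slQ Q0 by (simp add: abs_le_square_iff[symmetric])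
    ultimately have 2: "\<bar>(s * l)\<^sup>2 * (E - De)\<bar> \<le> Q\<^sup>2 * ((B + 3) * \<delta>)"
      by (simp add: abs_mult mult_mono)
    \<comment> \<open>Passing through \<open>(s * l)\<^sup>2 * E\<close> separates the error in
      \<open>q\<close> from the error in the denominator,
      \<open>E - De = k (s - w) + (1 - g\<^sup>2)\<close>.\<close>
    have "q\<^sup>2 * E - (s * l)\<^sup>2 * De = (q\<^sup>2 - (s * l)\<^sup>2) * E + (s * l)\<^sup>2 * (E - De)"
      by (simp add: algebra_simps)
    then have "\<bar>q\<^sup>2 * E - (s * l)\<^sup>2 * De\<bar> \<le> (2 * Q * (1 + C * B) + Q\<^sup>2 * (B + 3)) * \<delta>"
      using 1 2 by (simp add: algebra_simps abs_le_iff)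
    then have n: "\<bar>k * (q\<^sup>2 * E - (s * l)\<^sup>2 * De)\<bar> \<le> B * ((2 * Q * (1 + C * B) + Q\<^sup>2 * (B + 3)) * \<delta>)"
      using B by (simp add: abs_mult mult_mono)
    have "c * (1 / 4) * 1 \<le> s * De * E" using c De E1 s0 by (intro mult_mono) auto
    then have "\<bar>k * (q\<^sup>2 * E - (s * l)\<^sup>2 * De)\<bar> / (s * De * E)
      \<le> (B * ((2 * Q * (1 + C * B) + Q\<^sup>2 * (B + 3)) * \<delta>)) / (c * (1 / 4) * 1)"
      using n c by (intro frac_le order_trans[OF abs_ge_zero n]) auto
    moreover have "0 < s * De * E" using s0 De E1 by simp
    ultimately show ?thesis by (simp add: abs_divide algebra_simps)
  qed
  have "\<bar>(p - s) / s + (w * h\<^sup>2 - 2 * q * g * h) / (s * De) - k * (q\<^sup>2 * E - (s * l)\<^sup>2 * De) / (s * De * E)\<bar>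
    \<le> 1 / c * \<delta> + 4 * (C + 1 + 3 * Q) / c * \<delta> + 4 * B * (2 * Q * (1 + C * B) + Q\<^sup>2 * (B + 3)) / c * \<delta>"
    using t1 t2 t3 by linarith
  also have "\<dots> = Kc * \<delta>" unfolding Kc_def by (simp add: distrib_right)
  finally show ?thesis unfolding De_def[symmetric] E_def[symmetric] eq .
qed

text \<open>The remainder of the theorem at one sample size and one sample point. Rows are counted
  from 0, so row \<open>i\<close> is period \<open>i + 1\<close>: its lagged error is
  \<open>e i\<close>, its own error \<open>e (Suc i)\<close>, and the sum over
  \<open>{1..<n}\<close> is the one from \<open>t = 2\<close> to \<open>T\<close>.\<close>

definition ratio_gap :: "nat \<Rightarrow> nat \<Rightarrow> (nat \<Rightarrow> nat \<Rightarrow> real) \<Rightarrow> (nat \<Rightarrow> real) \<Rightarrow> (nat \<Rightarrow> real) \<Rightarrow> (nat \<Rightarrow> real) \<Rightarrow> real \<Rightarrow> real" where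
  "ratio_gap n k Xt e al be s = (
     let X = (\<lambda>i j. Xt i j + al j * e i);
         y = (\<lambda>i. (\<Sum>j<k. X i j * be j) + e (Suc i));
         Mh = resid_maker n k X;
         s2hat = qform n Mh y / (real n - real k);
         Mt = resid_maker n k Xt;
         Sbar = (\<lambda>i j. mmul n (mtr Xt) Xt i j + s * (real n - real k) * al i * al j)
     in s2hat / s
        - (1 - s * qform k (minv k Sbar) al / (real n - real k)
               * (\<Sum>i\<in>{1..<n}. Mt i (i - 1))\<^sup>2))"

text \<open>Dividing the quadratic forms by \<open>m\<close> and multiplying \<open>a0\<close> by
  \<open>m\<close> keeps the denominator \<open>a0 W + g\<^sup>2\<close> and puts all ingredients on
  a bounded scale, ready for \<open>limit_ratio_bound\<close>.\<close>

lemma ratio_gap_eq: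
  fixes n k Xt e al be s
  defines "m \<equiv> real n - real k" and "R \<equiv> resid_maker n k Xt" and "u \<equiv> \<lambda>i. e (Suc i)"
    and "A0 \<equiv> qform k (minv k (mmul n (mtr Xt) Xt)) al"
    and "d \<equiv> mv k Xt (mv k (minv k (mmul n (mtr Xt) Xt)) al)"
  defines "w \<equiv> dot n e (mv n R e) / m" and "q \<equiv> dot n e (mv n R u) / m" and "p \<equiv> dot n u (mv n R u) / m"
    and "h \<equiv> dot n d u" and "g \<equiv> 1 + dot n d e" and "l \<equiv> (\<Sum>i\<in>{1..<n}. R i (i - 1)) / m"
  assumes r: "full_col_rank n k Xt" and m: "0 < m" and w: "0 < w" and s: "0 < s"
  shows "ratio_gap n k Xt e al be s =
    (p + (w * h\<^sup>2 - 2 * q * g * h - (m * A0) * q\<^sup>2) / (m * A0 * w + g\<^sup>2)) / s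
      - (1 - s * (m * A0 / (1 + s * (m * A0))) * l\<^sup>2)"
proof -
  let ?W = "dot n e (mv n R e)" and ?D = "dot n e (mv n R u)" and ?U = "dot n u (mv n R u)"
  let ?L = "\<Sum>i\<in>{1..<n}. R i (i - 1)"
  have W: "?W > 0" using w m unfolding w_def by (simp add: zero_less_divide_iff)
  have y: "qform n (resid_maker n k (\<lambda>i j. Xt i j + al j * e i))
      (\<lambda>i. (\<Sum>j<k. (Xt i j + al j * e i) * be j) + e (Suc i))
    = ?U + (?W * h\<^sup>2 - 2 * ?D * g * h - A0 * ?D\<^sup>2) / (A0 * ?W + g\<^sup>2)"
    unfolding A0_def d_def h_def g_def R_def
    by (rule resid_maker_rank_one_update[OF r W[unfolded R_def]]) (simp add: mv_def u_def)
  have S: "qform k (minv k (\<lambda>i j. mmul n (mtr Xt) Xt i j + s * m * al i * al j)) al = A0 / (1 + s * m * A0)"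
    unfolding A0_def using m s by (intro qform_minv_rank_one_update[OF r]) simp
  have De: "m * A0 * w + g\<^sup>2 = A0 * ?W + g\<^sup>2" unfolding w_def using m by simp
  have "w * h\<^sup>2 - 2 * q * g * h - (m * A0) * q\<^sup>2 = (?W * h\<^sup>2 - 2 * ?D * g * h - A0 * ?D\<^sup>2) / m"
    unfolding w_def q_def using m by (simp add: field_simps power2_eq_square)
  then have 1: "p + (w * h\<^sup>2 - 2 * q * g * h - (m * A0) * q\<^sup>2) / (m * A0 * w + g\<^sup>2)
    = (?U + (?W * h\<^sup>2 - 2 * ?D * g * h - A0 * ?D\<^sup>2) / (A0 * ?W + g\<^sup>2)) / m"
    unfolding De p_def by (simp add: add_divide_distrib mult.commute)
  have 2: "s * (m * A0 / (1 + s * (m * A0))) * l\<^sup>2 = s * (A0 / (1 + s * m * A0)) / m * ?L\<^sup>2"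
    unfolding l_def using m by (simp add: power2_eq_square mult.assoc)
  show ?thesis
    unfolding ratio_gap_def Let_def m_def[symmetric] y S 1 2 R_def[symmetric] ..
qed

text \<open>Position \<open>(p, q)\<close> with \<open>p = Suc q\<close> is where the lagged error
  of row \<open>p\<close> and the error of row \<open>q\<close> are the same variable; these
  positions give the conditional mean of \<open>e'Mt u\<close>.\<close>

lemma sum_resid_subdiagonal:
  "(\<Sum>p<n. \<Sum>q<n. if p = Suc q then f p q else 0) = (\<Sum>i\<in>{1..<n}. f i (i - 1) :: real)"
proof -
  have "(\<Sum>q<n. if p = Suc q then f p q else 0) = (if p \<in> {1..<n} then f p (p - 1) else 0)" if "p < n" for p
  proof (cases p)
    case (Suc r)
    then show ?thesis using that by (simp add: sum.delta)
  qed simp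
  then have "(\<Sum>p<n. \<Sum>q<n. if p = Suc q then f p q else 0) = (\<Sum>p<n. if p \<in> {1..<n} then f p (p - 1) else 0)"
    by (intro sum.cong) auto
  also have "\<dots> = (\<Sum>p\<in>{..<n} \<inter> {1..<n}. f p (p - 1))" by (rule sum.inter_restrict[symmetric]) simp
  also have "{..<n} \<inter> {1..<n} = {1..<n}" by auto
  finally show ?thesis .
qed

text \<open>Since \<open>R'R = R\<close>, column \<open>j\<close> has squared length
  \<open>R j j\<close>. Summing gives the trace; a single entry gives
  \<open>(R i j)\<^sup>2 \<le> R j j\<close>, and \<open>i = j\<close> then forces
  \<open>R j j \<le> 1\<close>.\<close>

lemma resid_maker_bounds:
  assumes r: "full_col_rank m n X"
  shows "(\<Sum>i<m. \<Sum>j<m. (resid_maker m n X i j)\<^sup>2) = real m - real n"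
    "i < m \<Longrightarrow> j < m \<Longrightarrow> \<bar>resid_maker m n X i j\<bar> \<le> 1"
proof -
  let ?R = "resid_maker m n X"
  have sq: "(\<Sum>l<m. (?R l j)\<^sup>2) = ?R j j" if "j < m" for j
    using resid_maker_entries[OF r that that] by (simp add: power2_eq_square)
  have "(\<Sum>i<m. \<Sum>j<m. (?R i j)\<^sup>2) = (\<Sum>j<m. ?R j j)"
    by (subst sum.swap) (intro sum.cong refl sq; simp)
  then show "(\<Sum>i<m. \<Sum>j<m. (?R i j)\<^sup>2) = real m - real n" by (simp add: resid_maker_trace[OF r])
  have le: "(?R i j)\<^sup>2 \<le> ?R j j" if "i < m" "j < m" for i j
    using member_le_sum[of i "{..<m}" "\<lambda>l. (?R l j)\<^sup>2"] sq[OF that(2)] that by simp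
  have d1: "?R j j \<le> 1" if "j < m" for j
  proof (rule ccontr)
    assume "\<not> ?R j j \<le> 1"
    then have "?R j j < (?R j j)\<^sup>2" by (simp add: power2_eq_square)
    with le[OF that that] show False by simp
  qed
  show "\<bar>?R i j\<bar> \<le> 1" if "i < m" "j < m"
    using le[OF that] d1[OF that(2)] by (simp add: abs_square_le_1[symmetric])
qed

text \<open>A union bound over six events: \<open>n * a0\<close> exceeds \<open>B\<close>, three
  quadratic forms are off by more than \<open>\<delta> * m\<close>, two linear forms by more than
  \<open>\<delta>\<close>. The constant over \<open>n\<close> depends on \<open>c\<close>,
  \<open>C\<close>, \<open>B\<close> and \<open>\<delta>\<close> only.\<close>

lemma ratio_gap_prob_bound:
  fixes M :: "'a measure" and Xt :: "'a \<Rightarrow> nat \<Rightarrow> nat \<Rightarrow> real" and eps :: "nat \<Rightarrow> 'a \<Rightarrow> real"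
    and al be :: "nat \<Rightarrow> real" and sigma2 :: "'a \<Rightarrow> real" and c C B \<delta> t :: real and n k :: nat
  defines "F \<equiv> gen_sigma M n k Xt"
    and "Q \<equiv> C / c + 1"
  defines "Kc \<equiv> 1 / c + 4 * (C + 1 + 3 * Q) / c + 4 * B * (2 * Q * (1 + C * B) + Q\<^sup>2 * (B + 3)) / c"
  assumes M: "prob_space M" and n: "n \<ge> 1" and c: "0 < c" and C: "0 < C" and B: "0 \<le> B"
    and \<delta>: "0 < \<delta>" "\<delta> \<le> 1 / 2" "\<delta> \<le> c / 2" and t: "Kc * \<delta> \<le> t"
    and Xt_meas: "\<And>i j. (\<lambda>\<omega>. Xt \<omega> i j) \<in> borel_measurable M"
    and eps_meas: "\<And>t. eps t \<in> borel_measurable M"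
    and rank: "\<And>\<omega>. \<omega> \<in> space M \<Longrightarrow> full_col_rank n k (Xt \<omega>)"
    and iid: "cond_iid M F {0..n} eps"
    and eps_int4: "\<And>t. t \<le> n \<Longrightarrow> integrable M (\<lambda>\<omega>. eps t \<omega> ^ 4)"
    and mean0: "\<And>t. t \<le> n \<Longrightarrow> AE \<omega> in M. real_cond_exp M F (eps t) \<omega> = 0"
    and var: "\<And>t. t \<le> n \<Longrightarrow> AE \<omega> in M. real_cond_exp M F (\<lambda>\<omega>. (eps t \<omega>)\<^sup>2) \<omega> = sigma2 \<omega>"
    and var_bd: "AE \<omega> in M. c < sigma2 \<omega> \<and> sigma2 \<omega> < C"
    and m4: "\<And>t. t \<le> n \<Longrightarrow> AE \<omega> in M. real_cond_exp M F (\<lambda>\<omega>. eps t \<omega> ^ 4) \<omega> < C"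
    and kn: "real k / real n < 1 - c"
  shows "measure M {\<omega>\<in>space M. \<bar>ratio_gap n k (Xt \<omega>) (\<lambda>i. eps i \<omega>) al be (sigma2 \<omega>)\<bar> > t}
      \<le> measure M {\<omega>\<in>space M. \<bar>qform k (minv k (\<lambda>i j. mmul n (mtr (Xt \<omega>)) (Xt \<omega>) i j / real n)) al\<bar> > B}
        + (3 * ((4 * C + 4 * C\<^sup>2) / (\<delta>\<^sup>2 * c\<^sup>2)) + 2 * (2 * C * B / \<delta>\<^sup>2)) / real n"
proof -
  interpret prob_space M by fact
  have sub: "subalgebra M F" unfolding F_def by (rule subalgebra_gen_sigma[OF Xt_meas])
  interpret finite_measure_subalgebra M F by unfold_locales (rule sub)
  \<comment> \<open>\<open>sigma2\<close> itself need not be measurable.\<close>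
  define s2 where "s2 = real_cond_exp M F (\<lambda>\<omega>. (eps 0 \<omega>)\<^sup>2)"
  have s2_sigma2: "AE \<omega> in M. s2 \<omega> = sigma2 \<omega>" unfolding s2_def using var[of 0] by simp
  interpret cond_iid_moments M F "{0..n}" eps s2 C
  proof unfold_locales
    show "AE \<omega> in M. 0 \<le> s2 \<omega> \<and> s2 \<omega> \<le> C"
      using s2_sigma2 var_bd by eventually_elim (use c in auto)
    show "AE \<omega> in M. real_cond_exp M F (\<lambda>\<omega>. (eps j \<omega>)\<^sup>2) \<omega> = s2 \<omega>" if "j \<in> {0..n}" for j
      using var[of j] s2_sigma2 that by (auto elim: eventually_elim2)
    show "AE \<omega> in M. real_cond_exp M F (\<lambda>\<omega>. eps j \<omega> ^ 4) \<omega> \<le> C" if "j \<in> {0..n}" for j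
      using m4[of j] that by (auto elim: eventually_mono)
    show "s2 \<in> borel_measurable F" unfolding s2_def by simp
  qed (use iid eps_meas eps_int4 mean0 in auto)
  have spF: "space F = space M" using sub by (simp add: subalgebra_def)
  have n0: "0 < real n" using n by simp
  define m where "m = real n - real k"
  have m: "c * real n < m" "m \<le> real n" "0 < m"
  proof -
    have "real k < (1 - c) * real n" using kn n0 by (simp add: divide_less_eq)
    then show cm: "c * real n < m" unfolding m_def by (simp add: algebra_simps)
    show "m \<le> real n" unfolding m_def by simp
    have "0 < c * real n" using c n0 by simp
    with cm show "0 < m" by linarith
  qed
  define R where "R = (\<lambda>\<omega>. resid_maker n k (Xt \<omega>))"
  define A0 where "A0 = (\<lambda>\<omega>. qform k (minv k (mmul n (mtr (Xt \<omega>)) (Xt \<omega>))) al)"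
  define d where "d = (\<lambda>\<omega>. mv k (Xt \<omega>) (mv k (minv k (mmul n (mtr (Xt \<omega>)) (Xt \<omega>))) al))"
  have entF: "(\<lambda>\<omega>. Xt \<omega> i j) \<in> borel_measurable F" if "i < n" "j < k" for i j
    unfolding F_def using that by (rule gen_sigma_entry)
  have R_F: "(\<lambda>\<omega>. R \<omega> i j) \<in> borel_measurable F" if "i < n" "j < n" for i j
    unfolding R_def using entF rank spF that by (intro measurable_resid_maker) auto
  have d_F: "(\<lambda>\<omega>. d \<omega> i) \<in> borel_measurable F" if "i < n" for i
    unfolding d_def using entF rank spF that by (intro measurable_dual_vector) auto
  have A0_dot: "A0 \<omega> = dot n (d \<omega>) (d \<omega>)" if "\<omega> \<in> space M" for \<omega>
    unfolding A0_def d_def by (rule qform_minv_gram[OF rank[OF that]])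
  have A0_F: "A0 \<in> borel_measurable F"
  proof -
    have "(\<lambda>\<omega>. dot n (d \<omega>) (d \<omega>)) \<in> borel_measurable F"
      unfolding dot_def by (intro borel_measurable_sum borel_measurable_times d_F) auto
    then show ?thesis using A0_dot spF by (subst measurable_cong) auto
  qed
  have A0_nonneg: "0 \<le> A0 \<omega>" if "\<omega> \<in> space M" for \<omega>
    unfolding A0_dot[OF that] by (rule dot_nonneg)
  let ?nA = "\<lambda>\<omega>. qform k (minv k (\<lambda>i j. mmul n (mtr (Xt \<omega>)) (Xt \<omega>) i j / real n)) al"
  have nA: "?nA \<omega> = real n * A0 \<omega>" if "\<omega> \<in> space M" for \<omega>
    unfolding A0_def using n0 by (intro qform_minv_scale[OF adj_inv_gram[OF rank[OF that]]]) simp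
  have nA_meas: "?nA \<in> borel_measurable M"
    using n0 by (intro measurable_qform_minv_gram Xt_meas rank) auto
  \<comment> \<open>The linear forms need a pointwise bound on the squared length of their
    coefficients. Since \<open>A0\<close> is \<open>F\<close>-measurable, so is this cutoff, and
    outside \<open>?E1\<close> it equals 1.\<close>
  define ind where "ind = (\<lambda>\<omega>. if real n * A0 \<omega> \<le> B then 1 else 0 :: real)"
  define V where "V = (\<lambda>a b \<omega>. \<Sum>i<n. \<Sum>j<n. R \<omega> i j * \<xi> (a i) (b j) \<omega>)"
  define H where "H = (\<lambda>b \<omega>. \<Sum>i<n. (ind \<omega> * d \<omega> i) * eps (b i) \<omega>)"
  have ind_F: "ind \<in> borel_measurable F" unfolding ind_def using A0_F by measurable
  have V_meas: "V a b \<in> borel_measurable M" if "a ` {..<n} \<subseteq> {0..n}" "b ` {..<n} \<subseteq> {0..n}" for a b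
    unfolding V_def using that by (intro borel_measurable_sum borel_measurable_times F_M[OF R_F] \<xi>_M) auto
  have H_meas: "H b \<in> borel_measurable M" for b
    unfolding H_def by (intro borel_measurable_sum borel_measurable_times F_M[OF ind_F] F_M[OF d_F] eps_meas) auto
  have V_bound: "measure M {\<omega>\<in>space M. \<bar>V a b \<omega>\<bar> > \<delta> * m} \<le> (4 * C + 4 * C\<^sup>2) / (\<delta>\<^sup>2 * c\<^sup>2) / real n"
    if "inj_on a {..<n}" "a ` {..<n} \<subseteq> {0..n}" "inj_on b {..<n}" "b ` {..<n} \<subseteq> {0..n}" for a b
  proof -
    have "measure M {\<omega>\<in>space M. \<bar>V a b \<omega>\<bar> > \<delta> * m} \<le> (4 * C + 4 * C\<^sup>2) * real n / (\<delta> * m)\<^sup>2"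
      unfolding V_def
    proof (rule quadratic_form_reindex_bound[OF that])
      show "(\<Sum>i<n. \<Sum>j<n. (R \<omega> i j)\<^sup>2) \<le> real n" if "\<omega> \<in> space M" for \<omega>
        unfolding R_def resid_maker_bounds(1)[OF rank[OF that]] by simp
    qed (use R_F \<delta> m in auto)
    \<comment> \<open>\<open>m > c * n\<close> makes the denominator of order
      \<open>n\<^sup>2\<close>, which leaves one factor \<open>1 / n\<close>.\<close>
    also have "\<dots> \<le> (4 * C + 4 * C\<^sup>2) * real n / (\<delta>\<^sup>2 * (c * real n)\<^sup>2)"
    proof (rule divide_left_mono)
      have "(c * real n)\<^sup>2 \<le> m\<^sup>2" using m(1) c n0 by (intro power_mono) auto
      then show "\<delta>\<^sup>2 * (c * real n)\<^sup>2 \<le> (\<delta> * m)\<^sup>2" by (simp add: power_mult_distrib mult_left_mono)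
    qed (use C c n0 \<delta> m in auto)
    also have "\<dots> = (4 * C + 4 * C\<^sup>2) / (\<delta>\<^sup>2 * c\<^sup>2) / real n"
      using n0 by (simp add: power2_eq_square)
    finally show ?thesis .
  qed
  have H_bound: "measure M {\<omega>\<in>space M. \<bar>H b \<omega>\<bar> > \<delta>} \<le> 2 * C * B / \<delta>\<^sup>2 / real n"
    if "inj_on b {..<n}" "b ` {..<n} \<subseteq> {0..n}" for b
  proof -
    have "measure M {\<omega>\<in>space M. \<bar>H b \<omega>\<bar> > \<delta>} \<le> 2 * C * (B / real n) / \<delta>\<^sup>2"
      unfolding H_def
    proof (rule linear_form_reindex_bound[OF that])
      show "(\<lambda>\<omega>. ind \<omega> * d \<omega> p) \<in> borel_measurable F" if "p \<in> {..<n}" for p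
        using that by (intro borel_measurable_times ind_F d_F) auto
      show "(\<Sum>i<n. (ind \<omega> * d \<omega> i)\<^sup>2) \<le> B / real n" if "\<omega> \<in> space M" for \<omega>
      proof -
        have "(\<Sum>i<n. (ind \<omega> * d \<omega> i)\<^sup>2) = (ind \<omega>)\<^sup>2 * A0 \<omega>"
          unfolding A0_dot[OF that] dot_def by (simp add: sum_distrib_left power2_eq_square mult_ac)
        also have "\<dots> \<le> B / real n"
          unfolding ind_def using B n0 by (simp add: pos_le_divide_eq mult.commute)
        finally show ?thesis .
      qed
    qed fact
    then show ?thesis by (simp add: mult.commute)
  qed
  let ?id = "\<lambda>i::nat. i"
  have maps: "inj_on ?id {..<n}" "?id ` {..<n} \<subseteq> {0..n}" "inj_on Suc {..<n}" "Suc ` {..<n} \<subseteq> {0..n}"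
    by auto
  let ?E1 = "{\<omega>\<in>space M. \<bar>?nA \<omega>\<bar> > B}"
  let ?EV = "\<lambda>a b. {\<omega>\<in>space M. \<bar>V a b \<omega>\<bar> > \<delta> * m}"
  let ?EH = "\<lambda>b. {\<omega>\<in>space M. \<bar>H b \<omega>\<bar> > \<delta>}"
  let ?E = "?E1 \<union> (?EV ?id ?id \<union> (?EV Suc Suc \<union> (?EV ?id Suc \<union> (?EH ?id \<union> ?EH Suc))))"
  have sets: "?E1 \<in> sets M" "?EV ?id ?id \<in> sets M" "?EV Suc Suc \<in> sets M" "?EV ?id Suc \<in> sets M"
    "?EH ?id \<in> sets M" "?EH Suc \<in> sets M"
    using nA_meas V_meas[OF maps(2,2)] V_meas[OF maps(4,4)] V_meas[OF maps(2,4)] H_meas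
    by measurable
  \<comment> \<open>The centring of \<open>\<xi>\<close> contributes \<open>s2\<close> only where
    both index maps hit the same error: the diagonal for equal maps, the subdiagonal for
    \<open>?id\<close> and \<open>Suc\<close>.\<close>
  have V_eq: "V a b \<omega> = dot n (\<lambda>i. eps (a i) \<omega>) (mv n (R \<omega>) (\<lambda>i. eps (b i) \<omega>))
      - s2 \<omega> * (\<Sum>i<n. \<Sum>j<n. if a i = b j then R \<omega> i j else 0)" for a b \<omega>
  proof -
    have "V a b \<omega> = (\<Sum>i<n. \<Sum>j<n. eps (a i) \<omega> * (R \<omega> i j * eps (b j) \<omega>) - s2 \<omega> * (if a i = b j then R \<omega> i j else 0))"
      unfolding V_def \<xi>_def by (intro sum.cong refl) (auto simp: algebra_simps)
    then show ?thesis unfolding dot_def mv_def by (simp add: sum_subtractf sum_distrib_left)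
  qed
  have key: "\<bar>ratio_gap n k (Xt \<omega>) (\<lambda>i. eps i \<omega>) al be (s2 \<omega>)\<bar> \<le> t"
    if \<omega>: "\<omega> \<in> space M" "\<omega> \<notin> ?E" and s: "c < s2 \<omega>" "s2 \<omega> < C" for \<omega>
  proof -
    let ?e = "\<lambda>i. eps i \<omega>" and ?u = "\<lambda>i. eps (Suc i) \<omega>"
    let ?L = "\<Sum>i\<in>{1..<n}. R \<omega> i (i - 1)"
    note r = rank[OF \<omega>(1)]
    have not: "\<bar>?nA \<omega>\<bar> \<le> B" "\<bar>V ?id ?id \<omega>\<bar> \<le> \<delta> * m" "\<bar>V Suc Suc \<omega>\<bar> \<le> \<delta> * m" "\<bar>V ?id Suc \<omega>\<bar> \<le> \<delta> * m"
      "\<bar>H ?id \<omega>\<bar> \<le> \<delta>" "\<bar>H Suc \<omega>\<bar> \<le> \<delta>"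
      using \<omega> by auto
    have nB: "real n * A0 \<omega> \<le> B" using not(1) nA[OF \<omega>(1)] by simp
    have ind: "ind \<omega> = 1" using nB unfolding ind_def by simp
    have diag: "(\<Sum>i<n. \<Sum>j<n. if i = j then R \<omega> i j else 0) = m"
      unfolding m_def resid_maker_trace[OF r, symmetric] R_def by simp
    have close: "\<bar>x / m - t\<bar> \<le> \<delta>" if "\<bar>x - t * m\<bar> \<le> \<delta> * m" for x t
    proof -
      have "x / m - t = (x - t * m) / m" using m(3) by (simp add: field_simps)
      then have "\<bar>x / m - t\<bar> = \<bar>x - t * m\<bar> / m" using m(3) by (simp add: abs_divide)
      then show ?thesis using that m(3) by (simp add: divide_le_eq)
    qed
    have w: "\<bar>dot n ?e (mv n (R \<omega>) ?e) / m - s2 \<omega>\<bar> \<le> \<delta>"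
      using not(2) V_eq[of ?id ?id \<omega>] diag by (intro close) simp
    have p: "\<bar>dot n ?u (mv n (R \<omega>) ?u) / m - s2 \<omega>\<bar> \<le> \<delta>"
      using not(3) V_eq[of Suc Suc \<omega>] diag by (intro close) simp
    have q: "\<bar>dot n ?e (mv n (R \<omega>) ?u) / m - s2 \<omega> * (?L / m)\<bar> \<le> \<delta>"
      using not(4) V_eq[of ?id Suc \<omega>] m(3) by (intro close) (simp add: sum_resid_subdiagonal)
    have l: "\<bar>?L / m\<bar> \<le> 1 / c"
    proof -
      have "\<bar>?L\<bar> \<le> (\<Sum>i\<in>{1..<n}. \<bar>R \<omega> i (i - 1)\<bar>)" by (rule sum_abs)
      also have "\<dots> \<le> (\<Sum>i\<in>{1..<n}. 1)"
        unfolding R_def by (intro sum_mono resid_maker_bounds(2)[OF r]) auto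
      also have "\<dots> \<le> real n" by simp
      finally have "\<bar>?L\<bar> / m \<le> real n / (c * real n)" using m c n0 by (intro frac_le) auto
      then show ?thesis using m(3) n0 by (simp add: abs_divide)
    qed
    have h: "\<bar>dot n (d \<omega>) ?u\<bar> \<le> \<delta>" using not(6) unfolding H_def ind dot_def by simp
    have g: "\<bar>(1 + dot n (d \<omega>) ?e) - 1\<bar> \<le> \<delta>" using not(5) unfolding H_def ind dot_def by simp
    have k: "0 \<le> m * A0 \<omega>" "m * A0 \<omega> \<le> B"
      using m A0_nonneg[OF \<omega>(1)] order_trans[OF mult_right_mono[OF m(2)] nB] by auto
    \<comment> \<open>Positivity of \<open>W\<close>, required by
      \<open>resid_maker_rank_one_update\<close>, holds off the bad events because
      \<open>\<delta> \<le> c / 2 < s2 \<omega>\<close>.\<close>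
    have w0: "0 < dot n ?e (mv n (R \<omega>) ?e) / m" using w \<delta> c s by linarith
    have "ratio_gap n k (Xt \<omega>) (\<lambda>i. eps i \<omega>) al be (s2 \<omega>) =
      (dot n ?u (mv n (R \<omega>) ?u) / m + (dot n ?e (mv n (R \<omega>) ?e) / m * (dot n (d \<omega>) ?u)\<^sup>2
        - 2 * (dot n ?e (mv n (R \<omega>) ?u) / m) * (1 + dot n (d \<omega>) ?e) * dot n (d \<omega>) ?u
        - (m * A0 \<omega>) * (dot n ?e (mv n (R \<omega>) ?u) / m)\<^sup>2)
        / (m * A0 \<omega> * (dot n ?e (mv n (R \<omega>) ?e) / m) + (1 + dot n (d \<omega>) ?e)\<^sup>2)) / s2 \<omega>
      - (1 - s2 \<omega> * (m * A0 \<omega> / (1 + s2 \<omega> * (m * A0 \<omega>))) * (?L / m)\<^sup>2)"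
      using r m(3) w0 s c unfolding m_def R_def A0_def d_def
      by (intro ratio_gap_eq) auto
    then have "\<bar>ratio_gap n k (Xt \<omega>) (\<lambda>i. eps i \<omega>) al be (s2 \<omega>)\<bar> \<le> Kc * \<delta>"
      unfolding Kc_def Q_def
      using limit_ratio_bound[OF c s k \<delta> p w q l h g] by (simp only:)
    with t show ?thesis by simp
  qed
  have split: "(3 * a + 2 * b) / real n = 3 * (a / real n) + 2 * (b / real n)" for a b :: real
    by (simp add: add_divide_distrib)
  have sum_le: "x1 \<le> a \<Longrightarrow> x2 \<le> a \<Longrightarrow> x3 \<le> a \<Longrightarrow> y1 \<le> b \<Longrightarrow> y2 \<le> b \<Longrightarrow>
      x0 + (x1 + (x2 + (x3 + (y1 + y2)))) \<le> x0 + (3 * a + 2 * b)" for x0 x1 x2 x3 y1 y2 a b :: real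
    by linarith
  \<comment> \<open>Only the covering event \<open>?E\<close> has to be measurable here; replacing
    \<open>sigma2\<close> by \<open>s2\<close> costs a null set.\<close>
  have "measure M {\<omega>\<in>space M. \<bar>ratio_gap n k (Xt \<omega>) (\<lambda>i. eps i \<omega>) al be (sigma2 \<omega>)\<bar> > t} \<le> measure M ?E"
  proof (rule finite_measure_mono_AE)
    show "AE \<omega> in M. \<omega> \<in> {\<omega>\<in>space M. \<bar>ratio_gap n k (Xt \<omega>) (\<lambda>i. eps i \<omega>) al be (sigma2 \<omega>)\<bar> > t} \<longrightarrow> \<omega> \<in> ?E"
      using s2_sigma2 var_bd
    proof eventually_elim
      case (elim \<omega>)
      show ?case
      proof (intro impI, rule ccontr)
        assume a: "\<omega> \<in> {\<omega>\<in>space M. \<bar>ratio_gap n k (Xt \<omega>) (\<lambda>i. eps i \<omega>) al be (sigma2 \<omega>)\<bar> > t}"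
          and b: "\<omega> \<notin> ?E"
        from a have "\<omega> \<in> space M" by simp
        from key[OF this b] elim a show False by simp
      qed
    qed
    show "?E \<in> sets M" by (intro sets.Un sets)
  qed
  also have "\<dots> \<le> measure M ?E1 + (measure M (?EV ?id ?id) + (measure M (?EV Suc Suc)
      + (measure M (?EV ?id Suc) + (measure M (?EH ?id) + measure M (?EH Suc)))))"
    by (intro order_trans[OF measure_Un_le] add_left_mono sets.Un sets order_refl)
  also have "\<dots> \<le> measure M ?E1 + (3 * ((4 * C + 4 * C\<^sup>2) / (\<delta>\<^sup>2 * c\<^sup>2)) + 2 * (2 * C * B / \<delta>\<^sup>2)) / real n"
    using V_bound[OF maps(1,2,1,2)] V_bound[OF maps(3,4,3,4)] V_bound[OF maps(1,2,3,4)]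
      H_bound[OF maps(1,2)] H_bound[OF maps(3,4)]
    unfolding split by (rule sum_le)
  finally show "measure M {\<omega>\<in>space M. \<bar>ratio_gap n k (Xt \<omega>) (\<lambda>i. eps i \<omega>) al be (sigma2 \<omega>)\<bar> > t}
      \<le> measure M ?E1 + (3 * ((4 * C + 4 * C\<^sup>2) / (\<delta>\<^sup>2 * c\<^sup>2)) + 2 * (2 * C * B / \<delta>\<^sup>2)) / real n" .
qed

theorem theorem2:
  fixes M :: "'a measure"
    and K :: "nat \<Rightarrow> nat"
    and Xt :: "nat \<Rightarrow> 'a \<Rightarrow> nat \<Rightarrow> nat \<Rightarrow> real"
    and eps :: "nat \<Rightarrow> nat \<Rightarrow> 'a \<Rightarrow> real"
    and alpha beta r :: "nat \<Rightarrow> nat \<Rightarrow> real"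
    and sigma2 :: "nat \<Rightarrow> 'a \<Rightarrow> real"
    and c C :: real
  assumes M: "prob_space M"
    and c: "0 < c" "c < 1" and C: "0 < C"
    and Xt_meas: "\<And>T i j. (\<lambda>\<omega>. Xt T \<omega> i j) \<in> borel_measurable M"
    and eps_meas: "\<And>T t. eps T t \<in> borel_measurable M"
    and rank: "\<And>T \<omega>. T \<ge> 1 \<Longrightarrow> \<omega> \<in> space M \<Longrightarrow> full_col_rank T (K T) (Xt T \<omega>)"
    and iid: "\<And>T. T \<ge> 1 \<Longrightarrow> cond_iid M (gen_sigma M T (K T) (Xt T)) {0..T} (eps T)"
    and eps_int4: "\<And>T t. T \<ge> 1 \<Longrightarrow> t \<le> T \<Longrightarrow> integrable M (\<lambda>\<omega>. eps T t \<omega> ^ 4)"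
    and mean0: "\<And>T t. T \<ge> 1 \<Longrightarrow> t \<le> T \<Longrightarrow>
       AE \<omega> in M. real_cond_exp M (gen_sigma M T (K T) (Xt T)) (eps T t) \<omega> = 0"
    and var: "\<And>T t. T \<ge> 1 \<Longrightarrow> t \<le> T \<Longrightarrow>
       AE \<omega> in M. real_cond_exp M (gen_sigma M T (K T) (Xt T)) (\<lambda>\<omega>. (eps T t \<omega>)\<^sup>2) \<omega> = sigma2 T \<omega>"
    and var_bd: "\<And>T. T \<ge> 1 \<Longrightarrow> AE \<omega> in M. c < sigma2 T \<omega> \<and> sigma2 T \<omega> < C"
    and m4: "\<And>T t. T \<ge> 1 \<Longrightarrow> t \<le> T \<Longrightarrow>
       AE \<omega> in M. real_cond_exp M (gen_sigma M T (K T) (Xt T)) (\<lambda>\<omega>. eps T t \<omega> ^ 4) \<omega> < C"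
    and alpha_Op: "Op1 M (\<lambda>T \<omega>. qform (K T)
         (minv (K T) (\<lambda>i j. mmul T (mtr (Xt T \<omega>)) (Xt T \<omega>) i j / real T)) (alpha T))"
    and r_Op: "Op1 M (\<lambda>T \<omega>. qform (K T)
         (minv (K T) (\<lambda>i j. mmul T (mtr (Xt T \<omega>)) (Xt T \<omega>) i j / real T)) (r T))"
    and KT: "\<And>T. T \<ge> 1 \<Longrightarrow> real (K T) / real T < 1 - c"
  shows "op1 M (\<lambda>T \<omega>.
     let X = (\<lambda>i j. Xt T \<omega> i j + alpha T j * eps T i \<omega>);
         y = (\<lambda>i. (\<Sum>j<K T. X i j * beta T j) + eps T (Suc i) \<omega>);
         Mh = resid_maker T (K T) X;
         s2hat = qform T Mh y / (real T - real (K T));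
         Mt = resid_maker T (K T) (Xt T \<omega>);
         Sbar = (\<lambda>i j. mmul T (mtr (Xt T \<omega>)) (Xt T \<omega>) i j
                   + sigma2 T \<omega> * (real T - real (K T)) * alpha T i * alpha T j)
     in s2hat / sigma2 T \<omega>
        - (1 - sigma2 T \<omega> * qform (K T) (minv (K T) Sbar) (alpha T) / (real T - real (K T))
               * (\<Sum>i\<in>{1..<T}. Mt i (i - 1))\<^sup>2))"
proof -
  interpret prob_space M by (rule M)
  let ?Z = "\<lambda>T \<omega>. ratio_gap T (K T) (Xt T \<omega>) (\<lambda>i. eps T i \<omega>) (alpha T) (beta T) (sigma2 T \<omega>)"
  let ?A = "\<lambda>T \<omega>. qform (K T) (minv (K T) (\<lambda>i j. mmul T (mtr (Xt T \<omega>)) (Xt T \<omega>) i j / real T)) (alpha T)"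
  have "op1 M ?Z"
    unfolding op1_def
  proof (intro allI impI)
    fix d :: real assume d: "0 < d"
    show "(\<lambda>T. measure M {\<omega>\<in>space M. \<bar>?Z T \<omega>\<bar> > d}) \<longlonglongrightarrow> 0"
    proof (rule LIMSEQ_I)
      fix e :: real assume e: "0 < e"
      obtain B0 N where B0: "\<And>T. T \<ge> N \<Longrightarrow> measure M {\<omega>\<in>space M. \<bar>?A T \<omega>\<bar> > B0} < e / 2"
        using alpha_Op e unfolding Op1_def by (meson half_gt_zero)
      \<comment> \<open>\<open>Op1\<close> leaves the sign of its bound open, while the estimates
        use \<open>0 \<le> B\<close>.\<close>
      define B where "B = max B0 0"
      define Q where "Q = C / c + 1"
      define Kc where "Kc = 1 / c + 4 * (C + 1 + 3 * Q) / c + 4 * B * (2 * Q * (1 + C * B) + Q\<^sup>2 * (B + 3)) / c"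
      \<comment> \<open>Order of choice: \<open>B\<close> from the tolerance \<open>e\<close>,
        \<open>Kc\<close> from \<open>B\<close>, then \<open>\<delta>\<close> from \<open>Kc\<close>
        and \<open>d\<close>. None of them depends on \<open>T\<close>, so \<open>J / real T\<close>
        below tends to zero.\<close>
      define \<delta> where "\<delta> = Min {1 / 2, c / 2, d / Kc}"
      have B: "0 \<le> B" unfolding B_def by simp
      have Q: "0 < Q" unfolding Q_def using c C by (simp add: add_pos_pos)
      have "0 < 1 / c" "0 \<le> 4 * (C + 1 + 3 * Q) / c" "0 \<le> 4 * B * (2 * Q * (1 + C * B) + Q\<^sup>2 * (B + 3)) / c"
        using c C Q B by simp_all
      then have Kc: "0 < Kc" unfolding Kc_def by linarith
      have \<delta>: "0 < \<delta>" "\<delta> \<le> 1 / 2" "\<delta> \<le> c / 2" "Kc * \<delta> \<le> d"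
      proof -
        show "0 < \<delta>" unfolding \<delta>_def using c d Kc by simp
        show "\<delta> \<le> 1 / 2" "\<delta> \<le> c / 2" unfolding \<delta>_def by (intro Min_le; simp)+
        have "\<delta> \<le> d / Kc" unfolding \<delta>_def by simp
        then show "Kc * \<delta> \<le> d" using Kc by (simp add: pos_le_divide_eq mult.commute)
      qed
      define J where "J = 3 * ((4 * C + 4 * C\<^sup>2) / (\<delta>\<^sup>2 * c\<^sup>2)) + 2 * (2 * C * B / \<delta>\<^sup>2)"
      have "(\<lambda>T. J / real T) \<longlonglongrightarrow> 0" by (rule lim_const_over_n)
      then obtain N' where N': "\<And>T. T \<ge> N' \<Longrightarrow> \<bar>J / real T\<bar> < e / 2"
        using LIMSEQ_D[of "\<lambda>T. J / real T" 0 "e / 2"] e by auto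
      show "\<exists>no. \<forall>T\<ge>no. norm (measure M {\<omega>\<in>space M. \<bar>?Z T \<omega>\<bar> > d} - 0) < e"
      proof (intro exI allI impI)
        fix T assume T: "T \<ge> max 1 (max N N')"
        then have T1: "T \<ge> 1" by simp
        note bound = ratio_gap_prob_bound[OF M T1 c(1) C B \<delta>(1-3) _ Xt_meas eps_meas rank[OF T1] iid[OF T1]
            eps_int4[OF T1] mean0[OF T1] var[OF T1] var_bd[OF T1] m4[OF T1] KT[OF T1],
            where al="alpha T" and be="beta T" and t=d, folded Q_def, folded Kc_def, folded J_def, OF \<delta>(4)]
        have meas: "?A T \<in> borel_measurable M"
          using T1 by (intro measurable_qform_minv_gram Xt_meas rank) auto
        have A: "measure M {\<omega>\<in>space M. \<bar>?A T \<omega>\<bar> > B} \<le> measure M {\<omega>\<in>space M. \<bar>?A T \<omega>\<bar> > B0}"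
          using meas by (intro finite_measure_mono) (auto simp: B_def)
        have "T \<ge> N" "T \<ge> N'" using T by simp_all
        then show "norm (measure M {\<omega>\<in>space M. \<bar>?Z T \<omega>\<bar> > d} - 0) < e"
          using bound A B0[of T] N'[of T] measure_nonneg[of M "{\<omega>\<in>space M. \<bar>?Z T \<omega>\<bar> > d}"]
          unfolding real_norm_def by linarith
      qed
    qed
  qed
  then show ?thesis unfolding ratio_gap_def .
qed

end
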